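(* Assume that: (1) $c:\mathcal X\times\mathcal U\to\mathbb R$ is Borel measurable and $|c(x,u)|\le C_c<\infty$ for all $(x,u)$; (2) the filtered cost $g$ is Borel measurable, $\mathcal K$ is a Borel stochastic kernel on $\mathcal I$ given $\mathcal I\times\mathcal U$, and for every $v\in B_b(\mathcal I)$ the function $I\mapsto\inf_{u\in\mathcal U}\{g(I,u)+\alpha\int_{\mathcal I}v(I')\,\mathcal K(dI'\mid I,u)\}$ admits a bounded Borel measurable version. Then the Bellman operator $\mathcal B$ has a unique fixed point $V\in B_b(\mathcal I)$. Moreover $V=V^*$, $V^*=\mathcal BV^*$, and for every $v_0\in B_b(\mathcal I)$ and every $n$, $$\|\mathcal B^nv_0-V^*\|_\infty\le\alpha^n\|v_0-V^*\|_\infty .$$ In particular, $\|V^*\|_\infty\le \dfrac{C_c}{1-\alpha}$.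
   Context: Model. $\mathcal X$ (states), $\mathcal U$ (actions), $\mathsf E$, $\mathsf V$ (noises) are standard Borel spaces, $G:\mathcal X\times\mathcal U\times\mathsf E\times\mathsf V\to\mathcal X$ is Borel measurable, $\nu_\eta,\nu_\varepsilon$ are probability measures on $\mathsf E,\mathsf V$, and $Q(C\mid x,u)=\int_{\mathsf E}\int_{\mathsf V}\mathbf 1_C(G(x,u,e,v))\,\nu_\varepsilon(dv)\,\nu_\eta(de)$. $\mathcal P(\mathcal X)$ is the set of probability measures on $\mathcal X$ with the $\sigma$-field generated by the evaluations $\mu\mapsto\mu(C)$. The observable classes $O_1,\dots,O_{r+1}$ are pairwise disjoint measurable sets with union $\mathcal X$; $\mathsf J=\{j:O_j\neq\varnothing\}$. For $\mu\in\mathcal P(\mathcal X)$, $u\in\mathcal U$, $k\in\mathsf J$: $(\mathcal L_u\mu)(C)=\int_{\mathcal X}Q(C\mid x,u)\,\mu(dx)$; $p_k(\mu,u)=(\mathcal L_u\mu)(O_k)$; $\Phi_k(\mu,u)(C)=(\mathcal L_u\mu)(C\cap O_k)/p_k(\mu,u)$ if $p_k(\mu,u)>0$, and $\Phi_k(\mu,u)=\rho_k$ otherwise, where $\rho_k\in\mathcal P(\mathcal X)$ is fixed with $\rho_k(O_k)=1$. Information-state model. $\mathcal P_j=\{\mu\in\mathcal P(\mathcal X):\mu(O_j)=1\}$, $\mathcal I=\bigcup_{j\in\mathsf J}(\{j\}\times\mathcal P_j)$ with the trace $\sigma$-field of $\mathsf J\times\mathcal P(\mathcal X)$. For $I=(j,\mu)$: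 $\mathcal K(D\mid I,u)=\sum_{k\in\mathsf J}p_k(\mu,u)\mathbf 1_D\bigl((k,\Phi_k(\mu,u))\bigr)$ and $g(I,u)=\int_{\mathcal X}c(x,u)\,\mu(dx)$. All actions $u\in\mathcal U$ are admissible at every $I$. Control problem. $\alpha\in(0,1)$ is fixed. $\Gamma$ is the set of randomized history-dependent policies $\boldsymbol\gamma=\{\gamma_t\}_{t\ge0}$, $\gamma_t$ a stochastic kernel on $\mathcal U$ given $(I_0,U_0,\dots,U_{t-1},I_t)$. $J_{\boldsymbol\gamma}(I)=\mathbb E_I^{\boldsymbol\gamma}[\sum_{t\ge0}\alpha^tg(I_t,U_t)]$ is the expectation for the controlled Markov process with initial state $I$, transition kernel $\mathcal K$ and policy $\boldsymbol\gamma$; $V^*(I)=\inf_{\boldsymbol\gamma\in\Gamma}J_{\boldsymbol\gamma}(I)$. $B_b(\mathcal I)$ is the Banach space of bounded Borel functions on $\mathcal I$ with the supremum norm $\|\cdot\|_\infty$. The Bellman operator is $(\mathcal Bv)(I)=\inf_{u\in\mathcal U}\{g(I,u)+\alpha\int_{\mathcal I}v(I')\,\mathcal K(dI'\mid I,u)\}$. *)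

theory Defs
  imports "HOL-Probability.Probability"
begin

definition standard_borel :: "'a measure \<Rightarrow> bool" where
  "standard_borel N \<longleftrightarrow>
     (\<exists>T. completely_metrizable_space T \<and> separable_space T \<and>
          space N = topspace T \<and> sets N = sigma_sets (topspace T) {W. openin T W})"

text \<open>
  Model data. The measurable spaces \<open>X\<close>, \<open>U\<close> are given by measures of which only the carrier and
  the sigma-field matter; the noise spaces \<open>E\<close>, \<open>V\<close> are the underlying measurable spaces of the
  noise laws \<open>nuE\<close>, \<open>nuV\<close>. The observable classes are \<open>obs_class M j\<close> for \<open>1 \<le> j \<le> obs_r M + 1\<close>.
\<close>

record ('x, 'u, 'e, 'v) obs_model =
  stX :: "'x measure"
  actU :: "'u measure"
  nuE :: "'e measure"
  nuV :: "'v measure"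
  dynG :: "'x \<times> 'u \<times> 'e \<times> 'v \<Rightarrow> 'x"
  obs_r :: nat
  obs_class :: "nat \<Rightarrow> 'x set"
  rho :: "nat \<Rightarrow> 'x measure"

definition class_idx :: "('x, 'u, 'e, 'v) obs_model \<Rightarrow> nat set" where
  "class_idx M = {j \<in> {1..obs_r M + 1}. obs_class M j \<noteq> {}}"

definition wf_obs_model :: "('x, 'u, 'e, 'v) obs_model \<Rightarrow> bool" where
  "wf_obs_model M \<longleftrightarrow>
     standard_borel (stX M) \<and> space (stX M) \<noteq> {} \<and>
     standard_borel (actU M) \<and> space (actU M) \<noteq> {} \<and>
     standard_borel (nuE M) \<and> prob_space (nuE M) \<and>
     standard_borel (nuV M) \<and> prob_space (nuV M) \<and>
     dynG M \<in> stX M \<Otimes>\<^sub>M actU M \<Otimes>\<^sub>M nuE M \<Otimes>\<^sub>M nuV M \<rightarrow>\<^sub>M stX M \<and>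
     (\<forall>j\<in>{1..obs_r M + 1}. obs_class M j \<in> sets (stX M)) \<and>
     disjoint_family_on (obs_class M) {1..obs_r M + 1} \<and>
     (\<Union>j\<in>{1..obs_r M + 1}. obs_class M j) = space (stX M) \<and>
     (\<forall>k\<in>class_idx M. rho M k \<in> space (prob_algebra (stX M)) \<and>
                        measure (rho M k) (obs_class M k) = 1)"

definition transQ :: "('x, 'u, 'e, 'v) obs_model \<Rightarrow> 'x \<Rightarrow> 'u \<Rightarrow> 'x measure" where
  "transQ M x u = distr (nuE M \<Otimes>\<^sub>M nuV M) (stX M) (\<lambda>(e, v). dynG M (x, u, e, v))"

definition predL :: "('x, 'u, 'e, 'v) obs_model \<Rightarrow> 'u \<Rightarrow> 'x measure \<Rightarrow> 'x measure" where
  "predL M u \<mu> = \<mu> \<bind> (\<lambda>x. transQ M x u)"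

definition class_prob :: "('x, 'u, 'e, 'v) obs_model \<Rightarrow> nat \<Rightarrow> 'x measure \<Rightarrow> 'u \<Rightarrow> real" where
  "class_prob M k \<mu> u = measure (predL M u \<mu>) (obs_class M k)"

text \<open>\<open>uniform_measure N A\<close> is the conditional law \<open>C \<mapsto> N (A \<inter> C) / N A\<close>.\<close>

definition filterPhi ::
  "('x, 'u, 'e, 'v) obs_model \<Rightarrow> nat \<Rightarrow> 'x measure \<Rightarrow> 'u \<Rightarrow> 'x measure" where
  "filterPhi M k \<mu> u =
     (if class_prob M k \<mu> u > 0 then uniform_measure (predL M u \<mu>) (obs_class M k) else rho M k)"

text \<open>\<open>prob_algebra (stX M)\<close> is \<open>P(X)\<close> with the sigma-field generated by the evaluations.\<close>

definition info_space :: "('x, 'u, 'e, 'v) obs_model \<Rightarrow> (nat \<times> 'x measure) measure" where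
  "info_space M = restrict_space (count_space (class_idx M) \<Otimes>\<^sub>M prob_algebra (stX M))
     (SIGMA j:class_idx M. {\<mu> \<in> space (prob_algebra (stX M)). measure \<mu> (obs_class M j) = 1})"

text \<open>
  The law on \<open>J\<close> with weights \<open>p\<^sub>k(\<mu>, u)\<close>, pushed forward along \<open>k \<mapsto> (k, \<Phi>\<^sub>k(\<mu>, u))\<close>;
  see \<open>emeasure_info_kernel\<close> below for the sum formula.
\<close>

definition info_kernel ::
  "('x, 'u, 'e, 'v) obs_model \<Rightarrow> nat \<times> 'x measure \<Rightarrow> 'u \<Rightarrow> (nat \<times> 'x measure) measure" where
  "info_kernel M I u =
     distr (point_measure (class_idx M) (\<lambda>k. ennreal (class_prob M k (snd I) u))) (info_space M)
       (\<lambda>k. (k, filterPhi M k (snd I) u))"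

definition filtered_cost :: "('x \<times> 'u \<Rightarrow> real) \<Rightarrow> nat \<times> 'x measure \<Rightarrow> 'u \<Rightarrow> real" where
  "filtered_cost c I u = (\<integral>x. c (x, u) \<partial>(snd I))"

text \<open>
  Coordinate \<open>i\<close> of a trajectory is the pair \<open>(I\<^sub>i, U\<^sub>i)\<close>. The kernel \<open>\<gamma> t\<close> takes the first \<open>t\<close>
  coordinates together with the current state \<open>I\<^sub>t\<close>.
\<close>

definition policies ::
  "('x, 'u, 'e, 'v) obs_model \<Rightarrow>
   (nat \<Rightarrow> (nat \<Rightarrow> (nat \<times> 'x measure) \<times> 'u) \<times> (nat \<times> 'x measure) \<Rightarrow> 'u measure) set" where
  "policies M = {\<gamma>. \<forall>t. \<gamma> t \<in>
      (\<Pi>\<^sub>M i\<in>{0..<t}. info_space M \<Otimes>\<^sub>M actU M) \<Otimes>\<^sub>M info_space M \<rightarrow>\<^sub>M prob_algebra (actU M)}"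

definition step_law ::
  "('x, 'u, 'e, 'v) obs_model \<Rightarrow>
   (nat \<Rightarrow> (nat \<Rightarrow> (nat \<times> 'x measure) \<times> 'u) \<times> (nat \<times> 'x measure) \<Rightarrow> 'u measure) \<Rightarrow>
   nat \<times> 'x measure \<Rightarrow> nat \<Rightarrow> (nat \<Rightarrow> (nat \<times> 'x measure) \<times> 'u) \<Rightarrow>
   ((nat \<times> 'x measure) \<times> 'u) measure" where
  "step_law M \<gamma> I\<^sub>0 t \<omega> =
     (if t = 0 then return (info_space M) I\<^sub>0
      else info_kernel M (fst (\<omega> (t - 1))) (snd (\<omega> (t - 1)))) \<bind>
     (\<lambda>I. distr (\<gamma> t (\<omega>, I)) (info_space M \<Otimes>\<^sub>M actU M) (Pair I))"

text \<open>The Ionescu-Tulcea measure on infinite trajectories with one-step laws \<open>step_law\<close>.\<close>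

definition traj_law ::
  "('x, 'u, 'e, 'v) obs_model \<Rightarrow>
   (nat \<Rightarrow> (nat \<Rightarrow> (nat \<times> 'x measure) \<times> 'u) \<times> (nat \<times> 'x measure) \<Rightarrow> 'u measure) \<Rightarrow>
   nat \<times> 'x measure \<Rightarrow> (nat \<Rightarrow> (nat \<times> 'x measure) \<times> 'u) measure" where
  "traj_law M \<gamma> I\<^sub>0 =
     projective_family.lim UNIV
       (Ionescu_Tulcea.CI (step_law M \<gamma> I\<^sub>0) (\<lambda>_. info_space M \<Otimes>\<^sub>M actU M))
       (\<lambda>_. info_space M \<Otimes>\<^sub>M actU M)"

definition policy_cost ::
  "('x, 'u, 'e, 'v) obs_model \<Rightarrow> ('x \<times> 'u \<Rightarrow> real) \<Rightarrow> real \<Rightarrow>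
   (nat \<Rightarrow> (nat \<Rightarrow> (nat \<times> 'x measure) \<times> 'u) \<times> (nat \<times> 'x measure) \<Rightarrow> 'u measure) \<Rightarrow>
   nat \<times> 'x measure \<Rightarrow> real" where
  "policy_cost M c \<alpha> \<gamma> I =
     (\<integral>\<omega>. (\<Sum>t. \<alpha> ^ t * filtered_cost c (fst (\<omega> t)) (snd (\<omega> t))) \<partial>traj_law M \<gamma> I)"

text \<open>
  Functions on the information space are extensional, i.e. \<open>undefined\<close> off the carrier, so that
  equality of functions is equality on the carrier.
\<close>

definition opt_value ::
  "('x, 'u, 'e, 'v) obs_model \<Rightarrow> ('x \<times> 'u \<Rightarrow> real) \<Rightarrow> real \<Rightarrow> nat \<times> 'x measure \<Rightarrow> real" where
  "opt_value M c \<alpha> = (\<lambda>I\<in>space (info_space M). INF \<gamma>\<in>policies M. policy_cost M c \<alpha> \<gamma> I)"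

definition bellman ::
  "('x, 'u, 'e, 'v) obs_model \<Rightarrow> ('x \<times> 'u \<Rightarrow> real) \<Rightarrow> real \<Rightarrow>
   (nat \<times> 'x measure \<Rightarrow> real) \<Rightarrow> nat \<times> 'x measure \<Rightarrow> real" where
  "bellman M c \<alpha> v = (\<lambda>I\<in>space (info_space M).
     INF u\<in>space (actU M). filtered_cost c I u + \<alpha> * (\<integral>I'. v I' \<partial>info_kernel M I u))"

definition bdd_borel :: "'a measure \<Rightarrow> ('a \<Rightarrow> real) set" where
  "bdd_borel N = {v \<in> extensional (space N). v \<in> borel_measurable N \<and> bounded (v ` space N)}"

definition sup_norm :: "'a measure \<Rightarrow> ('a \<Rightarrow> real) \<Rightarrow> real" where
  "sup_norm N v = (SUP I\<in>space N. \<bar>v I\<bar>)"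


lemma space_info_space:
  "space (info_space M) =
     (SIGMA j:class_idx M. {\<mu> \<in> space (prob_algebra (stX M)). measure \<mu> (obs_class M j) = 1})"
  by (auto simp: info_space_def space_restrict_space space_pair_measure)

lemma transQ_measurable:
  assumes "wf_obs_model M" and u: "u \<in> space (actU M)"
  shows "(\<lambda>x. transQ M x u) \<in> stX M \<rightarrow>\<^sub>M prob_algebra (stX M)"
proof -
  have G[measurable]: "dynG M \<in> stX M \<Otimes>\<^sub>M actU M \<Otimes>\<^sub>M nuE M \<Otimes>\<^sub>M nuV M \<rightarrow>\<^sub>M stX M"
    and E: "prob_space (nuE M)" and V: "prob_space (nuV M)"
    using assms by (auto simp: wf_obs_model_def)
  interpret E: prob_space "nuE M" by (rule E)
  interpret V: prob_space "nuV M" by (rule V)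
  interpret EV: pair_prob_space "nuE M" "nuV M" ..
  note u[measurable]
  have "(\<lambda>x. distr (nuE M \<Otimes>\<^sub>M nuV M) (stX M) (\<lambda>w. dynG M (x, u, fst w, snd w)))
          \<in> stX M \<rightarrow>\<^sub>M prob_algebra (stX M)"
    by (rule measurable_distr_prob_space2[where M = "nuE M \<Otimes>\<^sub>M nuV M"])
       (simp_all add: space_prob_algebra EV.prob_space_axioms)
  then show ?thesis
    by (simp add: transQ_def[abs_def] case_prod_beta')
qed

lemma emeasure_transQ:
  assumes "wf_obs_model M" "x \<in> space (stX M)" "u \<in> space (actU M)" "C \<in> sets (stX M)"
  shows "emeasure (transQ M x u) C =
           (\<integral>\<^sup>+e. \<integral>\<^sup>+v. indicator C (dynG M (x, u, e, v)) \<partial>nuV M \<partial>nuE M)"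
proof -
  have G[measurable]: "dynG M \<in> stX M \<Otimes>\<^sub>M actU M \<Otimes>\<^sub>M nuE M \<Otimes>\<^sub>M nuV M \<rightarrow>\<^sub>M stX M"
    and V: "prob_space (nuV M)"
    using assms by (auto simp: wf_obs_model_def)
  interpret V: prob_space "nuV M" by (rule V)
  note assms(2-4)[measurable]
  have "emeasure (transQ M x u) C = (\<integral>\<^sup>+y. indicator C y \<partial>transQ M x u)"
    using assms by (simp add: transQ_def)
  also have "\<dots> = (\<integral>\<^sup>+w. indicator C (dynG M (x, u, fst w, snd w)) \<partial>(nuE M \<Otimes>\<^sub>M nuV M))"
    unfolding transQ_def by (subst nn_integral_distr) (auto simp: case_prod_beta')
  also have "\<dots> = (\<integral>\<^sup>+e. \<integral>\<^sup>+v. indicator C (dynG M (x, u, e, v)) \<partial>nuV M \<partial>nuE M)"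
    by (subst V.nn_integral_fst[symmetric]) auto
  finally show ?thesis .
qed

lemma predL_in_prob_algebra:
  assumes "wf_obs_model M" "\<mu> \<in> space (prob_algebra (stX M))" "u \<in> space (actU M)"
  shows "predL M u \<mu> \<in> space (prob_algebra (stX M))"
  using prob_space_bind'[OF assms(2) transQ_measurable[OF assms(1,3)]]
    sets_bind'[OF assms(2) transQ_measurable[OF assms(1,3)]]
  by (simp add: space_prob_algebra predL_def)

lemma emeasure_predL:
  assumes "wf_obs_model M" "\<mu> \<in> space (prob_algebra (stX M))" "u \<in> space (actU M)"
    and "C \<in> sets (stX M)"
  shows "emeasure (predL M u \<mu>) C = (\<integral>\<^sup>+x. emeasure (transQ M x u) C \<partial>\<mu>)"
  unfolding predL_def
  by (rule emeasure_bind_prob_algebra[OF assms(2) transQ_measurable[OF assms(1,3)] assms(4)])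

lemma filterPhi_in_info_space:
  assumes "wf_obs_model M" "\<mu> \<in> space (prob_algebra (stX M))" "u \<in> space (actU M)"
    and k: "k \<in> class_idx M"
  shows "(k, filterPhi M k \<mu> u) \<in> space (info_space M)"
proof (cases "class_prob M k \<mu> u > 0")
  case True
  have L: "prob_space (predL M u \<mu>)" "sets (predL M u \<mu>) = sets (stX M)"
    using predL_in_prob_algebra[OF assms(1-3)] by (auto simp: space_prob_algebra)
  interpret L: prob_space "predL M u \<mu>" by (rule L)
  have O: "obs_class M k \<in> sets (predL M u \<mu>)"
    using assms(1) k L(2) by (auto simp: wf_obs_model_def class_idx_def)
  have pos: "emeasure (predL M u \<mu>) (obs_class M k) \<noteq> 0"
    using True by (auto simp: class_prob_def measure_def)
  have "prob_space (uniform_measure (predL M u \<mu>) (obs_class M k))"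
    using pos by (intro prob_space_uniform_measure) auto
  moreover have "measure (uniform_measure (predL M u \<mu>) (obs_class M k)) (obs_class M k) = 1"
    using emeasure_uniform_measure_1[OF pos] by (simp add: measure_def)
  ultimately show ?thesis
    using True k L(2) by (simp add: space_info_space filterPhi_def space_prob_algebra)
next
  case False
  then show ?thesis
    using assms(1) k by (auto simp: space_info_space filterPhi_def wf_obs_model_def)
qed

lemma emeasure_info_kernel:
  assumes "wf_obs_model M" "I \<in> space (info_space M)" "u \<in> space (actU M)"
    and D: "D \<in> sets (info_space M)"
  shows "emeasure (info_kernel M I u) D =
           (\<Sum>k\<in>class_idx M. ennreal (class_prob M k (snd I) u) *
              indicator D (k, filterPhi M k (snd I) u))"
proof -
  let ?f = "\<lambda>k. (k, filterPhi M k (snd I) u)"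
  have fin: "finite (class_idx M)" by (simp add: class_idx_def)
  have m: "?f \<in> point_measure (class_idx M) (\<lambda>k. ennreal (class_prob M k (snd I) u))
             \<rightarrow>\<^sub>M info_space M"
  proof (rule measurableI)
    have "snd I \<in> space (prob_algebra (stX M))"
      using assms(2) by (auto simp: space_info_space)
    then show "?f k \<in> space (info_space M)"
      if "k \<in> space (point_measure (class_idx M) (\<lambda>k. ennreal (class_prob M k (snd I) u)))" for k
      using that assms(1,3) by (auto simp: space_point_measure intro: filterPhi_in_info_space)
  qed (simp add: space_point_measure sets_point_measure)
  have "emeasure (info_kernel M I u) D =
          (\<Sum>k\<in>?f -` D \<inter> class_idx M. ennreal (class_prob M k (snd I) u))"
    unfolding info_kernel_def
    by (subst emeasure_distr[OF m D]) (simp add: space_point_measure emeasure_point_measure_finite fin)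
  also have "\<dots> = (\<Sum>k\<in>class_idx M. ennreal (class_prob M k (snd I) u) * indicator D (?f k))"
    by (rule sum.mono_neutral_cong_left) (auto simp: fin split: split_indicator)
  finally show ?thesis .
qed

lemma Ionescu_Tulcea_step_law:
  assumes "wf_obs_model M" and I: "I\<^sub>0 \<in> space (info_space M)" and \<gamma>: "\<gamma> \<in> policies M"
    and K: "(\<lambda>(I, u). info_kernel M I u) \<in>
              info_space M \<Otimes>\<^sub>M actU M \<rightarrow>\<^sub>M prob_algebra (info_space M)"
  shows "Ionescu_Tulcea (step_law M \<gamma> I\<^sub>0) (\<lambda>_. info_space M \<Otimes>\<^sub>M actU M)"
proof -
  let ?S = "info_space M \<Otimes>\<^sub>M actU M"
  have P: "step_law M \<gamma> I\<^sub>0 t \<in> (\<Pi>\<^sub>M i\<in>{0..<t}. ?S) \<rightarrow>\<^sub>M prob_algebra ?S" for t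
  proof -
    have [measurable]: "\<gamma> t \<in> (\<Pi>\<^sub>M i\<in>{0..<t}. ?S) \<Otimes>\<^sub>M info_space M \<rightarrow>\<^sub>M prob_algebra (actU M)"
      using \<gamma> by (simp add: policies_def)
    have 1: "(\<lambda>\<omega>. if t = 0 then return (info_space M) I\<^sub>0
                  else info_kernel M (fst (\<omega> (t - 1))) (snd (\<omega> (t - 1))))
              \<in> (\<Pi>\<^sub>M i\<in>{0..<t}. ?S) \<rightarrow>\<^sub>M prob_algebra (info_space M)"
    proof (cases "t = 0")
      case True
      then show ?thesis using I by (auto simp: space_prob_algebra prob_space_return)
    next
      case False
      then have "(\<lambda>\<omega>. \<omega> (t - 1)) \<in> (\<Pi>\<^sub>M i\<in>{0..<t}. ?S) \<rightarrow>\<^sub>M ?S"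
        by (intro measurable_component_singleton) auto
      from measurable_compose[OF this K] False show ?thesis
        by (simp add: case_prod_beta')
    qed
    have 2: "(\<lambda>(\<omega>, I). distr (\<gamma> t (\<omega>, I)) ?S (Pair I))
              \<in> (\<Pi>\<^sub>M i\<in>{0..<t}. ?S) \<Otimes>\<^sub>M info_space M \<rightarrow>\<^sub>M prob_algebra ?S"
      unfolding case_prod_beta'
      by (rule measurable_distr_prob_space2[where M = "actU M"]) auto
    show ?thesis
      unfolding step_law_def by (rule measurable_bind_prob_space2[OF 1 2])
  qed
  show ?thesis
  proof (rule Ionescu_Tulcea.intro)
    show "step_law M \<gamma> I\<^sub>0 t \<in> (\<Pi>\<^sub>M i\<in>{0..<t}. ?S) \<rightarrow>\<^sub>M subprob_algebra ?S" for t
      by (rule measurable_prob_algebraD[OF P])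
    show "prob_space (step_law M \<gamma> I\<^sub>0 t \<omega>)" if "\<omega> \<in> space (\<Pi>\<^sub>M i\<in>{0..<t}. ?S)" for t \<omega>
      using measurable_space[OF P that] by (simp add: space_prob_algebra)
  qed
qed

lemma emeasure_traj_law:
  assumes "wf_obs_model M" "I\<^sub>0 \<in> space (info_space M)" "\<gamma> \<in> policies M"
    and "(\<lambda>(I, u). info_kernel M I u) \<in>
           info_space M \<Otimes>\<^sub>M actU M \<rightarrow>\<^sub>M prob_algebra (info_space M)"
    and "finite J" "A \<in> sets (\<Pi>\<^sub>M i\<in>J. info_space M \<Otimes>\<^sub>M actU M)"
  shows "emeasure (traj_law M \<gamma> I\<^sub>0) (prod_emb UNIV (\<lambda>_. info_space M \<Otimes>\<^sub>M actU M) J A) =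
           emeasure (Ionescu_Tulcea.CI (step_law M \<gamma> I\<^sub>0) (\<lambda>_. info_space M \<Otimes>\<^sub>M actU M) J) A"
  unfolding traj_law_def
  by (rule Ionescu_Tulcea.lim[OF Ionescu_Tulcea_step_law[OF assms(1-4)] assms(5,6)])

end

theory Submission
  imports Defs
begin

text \<open>
  The Bellman operator is an \<open>\<alpha>\<close>-contraction for the supremum norm, and the hypothesis on
  the infimum says that it maps bounded Borel functions to bounded Borel functions. The iterates
  from zero therefore converge uniformly to a bounded Borel fixed point
  (\<open>bdd_borel_contraction_fixed_point\<close>). What remains is that every bounded Borel fixed point
  \<open>V\<close> is the optimal value; this also gives uniqueness, and the error bound is the contraction
  estimate iterated.

  Both inequalities between \<open>V\<close> and the optimal value come from one formula. Write
  \<open>gap V (I, u) = g(I, u) + \<alpha> \<integral> V dK(\<cdot> | I, u) - V(I)\<close> for the loss incurred by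
  choosing \<open>u\<close> in \<open>I\<close>. Telescoping the discounted expectations of \<open>V\<close> along the trajectory
  shows, for every policy and every initial state,
  \<open>J(I\<^sub>0) - V(I\<^sub>0) = \<Sum>\<^sub>t \<alpha>^t E[gap V (I\<^sub>t, U\<^sub>t)]\<close> (\<open>performance_identity\<close>).
  If \<open>V\<close> is a fixed point then the gap is nonnegative, so no policy costs less than \<open>V\<close>
  (\<open>value_le_policy_cost\<close>).

  For the converse one wants a policy under which the expected gap is at most \<open>\<epsilon>\<close> at every
  time. An arbitrary selector \<open>s\<close> of \<open>\<epsilon>\<close>-optimal actions need not be measurable, so
  \<open>u = s(I)\<close> is in general not an admissible policy. But the policy may depend on the initial
  state, and from a fixed \<open>I\<^sub>0\<close> the kernel offers only finitely many successors, one for each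
  class label. Under deterministic actions the state at time \<open>t\<close> is thus a function \<open>replay\<close> of
  the finite list of labels seen so far. The policy that reads the labels, recomputes the state and
  applies \<open>s\<close> to it factors through a countable discrete space, and is measurable whatever \<open>s\<close> is.

  The state coincides with its recomputed version almost surely, but that event need not be
  manipulated: it is enough to know that an integrand which is at most \<open>B\<close> at all recomputed
  states has expectation at most \<open>B\<close> (\<open>nn_integral_state_le\<close>), and this statement passes
  through the induction on time.
\<close>

section \<open>Contractions on bounded Borel functions\<close>

lemma bdd_borelD:
  assumes "v \<in> bdd_borel N"
  shows "v \<in> borel_measurable N" "v \<in> extensional (space N)"
    and "\<exists>B\<ge>0. \<forall>x\<in>space N. \<bar>v x\<bar> \<le> B"
proof -
  show "v \<in> borel_measurable N" "v \<in> extensional (space N)"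
    using assms by (auto simp: bdd_borel_def)
  obtain B where "\<forall>x\<in>space N. \<bar>v x\<bar> \<le> B"
    using assms by (auto simp: bdd_borel_def bounded_iff)
  then show "\<exists>B\<ge>0. \<forall>x\<in>space N. \<bar>v x\<bar> \<le> B"
    by (intro exI[of _ "max 0 B"]) (auto intro: max.coboundedI2)
qed

lemma bdd_borelI:
  assumes "v \<in> borel_measurable N" "v \<in> extensional (space N)"
    and "\<And>x. x \<in> space N \<Longrightarrow> \<bar>v x\<bar> \<le> B"
  shows "v \<in> bdd_borel N"
  using assms by (auto simp: bdd_borel_def bounded_iff)

text \<open>
  Picard iteration from zero. The limit is taken pointwise, which keeps it Borel; the geometric bound
  on the remaining distance, \<open>tail\<close> below, makes the convergence uniform, which is what allows the
  limit to pass through \<open>T\<close>.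
\<close>
lemma bdd_borel_contraction_fixed_point:
  fixes T :: "('a \<Rightarrow> real) \<Rightarrow> 'a \<Rightarrow> real"
  assumes maps: "\<And>v. v \<in> bdd_borel N \<Longrightarrow> T v \<in> bdd_borel N"
    and contr: "\<And>v w d x. v \<in> bdd_borel N \<Longrightarrow> w \<in> bdd_borel N \<Longrightarrow>
        (\<And>y. y \<in> space N \<Longrightarrow> \<bar>v y - w y\<bar> \<le> d) \<Longrightarrow> x \<in> space N \<Longrightarrow> \<bar>T v x - T w x\<bar> \<le> \<alpha> * d"
    and \<alpha>: "0 < \<alpha>" "\<alpha> < 1"
  shows "\<exists>V\<in>bdd_borel N. T V = V"
proof -
  define w where "w n = (T ^^ n) (\<lambda>x\<in>space N. 0)" for n
  have w0: "w 0 \<in> bdd_borel N"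
    by (rule bdd_borelI[where B = 0]) (auto simp: w_def cong: measurable_cong)
  have w: "w n \<in> bdd_borel N" for n
  proof (induction n)
    case (Suc n)
    then show ?case using maps by (simp add: w_def)
  qed (rule w0)
  have wSuc: "w (Suc n) = T (w n)" for n
    by (simp add: w_def)
  obtain D where D: "D \<ge> 0" "\<And>x. x \<in> space N \<Longrightarrow> \<bar>w (Suc 0) x\<bar> \<le> D"
    using bdd_borelD(3)[OF w] by blast
  have step: "\<bar>w (Suc n) x - w n x\<bar> \<le> \<alpha> ^ n * D" if "x \<in> space N" for n x
    using that
  proof (induction n arbitrary: x)
    case 0
    then show ?case using D(2) by (simp add: w_def)
  next
    case (Suc n)
    from contr[OF w[of "Suc n"] w[of n] Suc.IH Suc.prems] show ?case
      by (simp add: wSuc[symmetric] mult.assoc)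
  qed
  define tail where "tail n = \<alpha> ^ n * D / (1 - \<alpha>)" for n
  have tail_lim: "tail \<longlonglongrightarrow> 0"
    unfolding tail_def using \<alpha> by (auto intro!: tendsto_eq_intros LIMSEQ_power_zero)
  have tail_Suc: "\<alpha> ^ n * D + tail (Suc n) = tail n" for n
    using \<alpha> by (simp add: tail_def field_simps)
  define V where "V = (\<lambda>x\<in>space N. lim (\<lambda>n. w n x))"
  have far: "\<bar>w (n + k) x - w n x\<bar> \<le> tail n - tail (n + k)" if "x \<in> space N" for n k x
  proof (induction k)
    case (Suc k)
    then show ?case
      using step[OF that, of "n + k"] tail_Suc[of "n + k"] by simp
  qed simp
  have tail_nonneg: "tail n \<ge> 0" for n
    using \<alpha> D(1) by (simp add: tail_def)
  have lim: "(\<lambda>n. w n x) \<longlonglongrightarrow> V x" if x: "x \<in> space N" for x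
  proof -
    have "Cauchy (\<lambda>n. w n x)"
    proof (rule metric_CauchyI)
      fix e :: real assume "e > 0"
      then obtain n where n: "tail n < e / 2"
        using order_tendstoD(2)[OF tail_lim, of "e / 2"] by (auto simp: eventually_sequentially)
      have "\<bar>w m x - w n x\<bar> < e / 2" if "m \<ge> n" for m
        using far[OF x, of n "m - n"] tail_nonneg[of m] n that by simp
      then have "dist (w m x) (w m' x) < e" if "m \<ge> n" "m' \<ge> n" for m m'
        using that unfolding dist_real_def by (smt (verit) field_sum_of_halves)
      then show "\<exists>n. \<forall>m\<ge>n. \<forall>m'\<ge>n. dist (w m x) (w m' x) < e"
        by blast
    qed
    then show ?thesis
      using x by (simp add: V_def Cauchy_convergent_iff convergent_LIMSEQ_iff)
  qed
  have close: "\<bar>V x - w n x\<bar> \<le> tail n" if x: "x \<in> space N" for x n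
  proof (rule LIMSEQ_le_const2)
    show "(\<lambda>k. \<bar>w k x - w n x\<bar>) \<longlonglongrightarrow> \<bar>V x - w n x\<bar>"
      by (intro tendsto_intros lim x)
    show "\<exists>m. \<forall>k\<ge>m. \<bar>w k x - w n x\<bar> \<le> tail n"
    proof (intro exI[of _ n] allI impI)
      fix k assume "n \<le> k"
      then show "\<bar>w k x - w n x\<bar> \<le> tail n"
        using far[OF x, of n "k - n"] tail_nonneg[of k] by simp
    qed
  qed
  have V: "V \<in> bdd_borel N"
  proof (rule bdd_borelI)
    show "V \<in> borel_measurable N"
      by (rule borel_measurable_LIMSEQ_real[OF lim]) (auto intro: bdd_borelD(1)[OF w])
    show "\<bar>V x\<bar> \<le> tail 0" if "x \<in> space N" for x
      using close[OF that, of 0] that by (simp add: w_def)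
  qed (simp add: V_def)
  have "T V x = V x" if x: "x \<in> space N" for x
  proof -
    have "\<bar>T V x - V x\<bar> \<le> \<alpha> * tail n + tail (Suc n)" for n
      using contr[OF V w[of n] close x] close[OF x, of "Suc n"]
      unfolding wSuc by linarith
    moreover have "(\<lambda>n. \<alpha> * tail n + tail (Suc n)) \<longlonglongrightarrow> 0"
      using tail_lim LIMSEQ_Suc[OF tail_lim] by (auto intro!: tendsto_eq_intros)
    ultimately have "\<bar>T V x - V x\<bar> \<le> 0"
      by (intro LIMSEQ_le_const[where X = "\<lambda>n. \<alpha> * tail n + tail (Suc n)"]) auto
    then show ?thesis by simp
  qed
  then have "T V = V"
    using bdd_borelD(2)[OF V] bdd_borelD(2)[OF maps[OF V]] by (intro extensionalityI) auto
  with V show ?thesis by blast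
qed

section \<open>One step of an Ionescu-Tulcea trajectory\<close>

text \<open>
  The first \<open>n\<close> coordinates of the limit measure follow the \<open>n\<close>-fold composition \<open>C 0 n\<close> of the
  one-step kernels. This reduces statements about infinite trajectories to the recursion for \<open>C\<close>.
\<close>
lemma (in Ionescu_Tulcea) nn_integral_lim_restrict:
  assumes h: "h \<in> borel_measurable (PiM {0..<n} M)"
  shows "(\<integral>\<^sup>+\<omega>. h (restrict \<omega> {0..<n}) \<partial>PF.lim) = (\<integral>\<^sup>+\<omega>. h \<omega> \<partial>C 0 n (\<lambda>_. undefined))"
proof -
  have up: "up_to {0..<n} = n"
    using up_to[of "{0..<n}"] by (intro antisym) (auto simp: up_to_iff)
  have [measurable]: "(\<lambda>\<omega>. restrict \<omega> {0..<n}) \<in> PF.lim \<rightarrow>\<^sub>M PiM {0..<n} M"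
    by (simp add: measurable_cong_sets[OF PF.sets_lim refl])
  have [measurable]: "(\<lambda>\<omega>. restrict \<omega> {0..<n}) \<in> C 0 n (\<lambda>_. undefined) \<rightarrow>\<^sub>M PiM {0..<n} M"
    by (simp add: measurable_cong_sets[OF sets_C refl])
  note h[measurable]
  have "(\<integral>\<^sup>+\<omega>. h (restrict \<omega> {0..<n}) \<partial>PF.lim) = (\<integral>\<^sup>+\<omega>. h \<omega> \<partial>CI {0..<n})"
    by (simp add: distr_lim[symmetric] nn_integral_distr)
  also have "\<dots> = (\<integral>\<^sup>+\<omega>. h (restrict \<omega> {0..<n}) \<partial>C 0 n (\<lambda>_. undefined))"
    by (simp add: CI_def up nn_integral_distr)
  also have "\<dots> = (\<integral>\<^sup>+\<omega>. h \<omega> \<partial>C 0 n (\<lambda>_. undefined))"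
    by (intro nn_integral_cong) (auto simp: space_C space_PiM)
  finally show ?thesis .
qed

lemma (in Ionescu_Tulcea) prob_space_lim: "prob_space PF.lim"
proof
  interpret C: prob_space "C 0 0 (\<lambda>_. undefined)"
    by (rule prob_space_C) (simp add: space_PiM)
  have "emeasure PF.lim (space PF.lim) = (\<integral>\<^sup>+\<omega>. 1 \<partial>PF.lim)"
    by (simp only: nn_integral_const) simp
  also have "\<dots> = (\<integral>\<^sup>+\<omega>. 1 \<partial>C 0 0 (\<lambda>_. undefined))"
    by (rule nn_integral_lim_restrict) simp
  also have "\<dots> = 1"
    by (simp only: nn_integral_const C.emeasure_space_1 mult_1)
  finally show "emeasure PF.lim (space PF.lim) = 1" .
qed

text \<open>
  The Markov-type disintegration: given the coordinates before \<open>n\<close>, coordinate \<open>n\<close> has law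
  \<open>P n\<close>. The conditional law is integrated against the limit measure itself, so that the identity can
  be applied repeatedly without leaving the trajectory space.
\<close>
lemma (in Ionescu_Tulcea) nn_integral_lim_step:
  assumes f: "(\<lambda>(\<omega>, y). f \<omega> y) \<in> borel_measurable (PiM {0..<n} M \<Otimes>\<^sub>M M n)"
  shows "(\<integral>\<^sup>+\<omega>. f (restrict \<omega> {0..<n}) (\<omega> n) \<partial>PF.lim) =
         (\<integral>\<^sup>+\<omega>. (\<integral>\<^sup>+y. f (restrict \<omega> {0..<n}) y \<partial>P n (restrict \<omega> {0..<n})) \<partial>PF.lim)"
proof -
  let ?h = "\<lambda>\<omega>. f (restrict \<omega> {0..<n}) (\<omega> n)"
  have 1: "(\<lambda>\<omega>. (restrict \<omega> {0..<n}, \<omega> n)) \<in> PiM {0..<Suc n} M \<rightarrow>\<^sub>M PiM {0..<n} M \<Otimes>\<^sub>M M n"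
    by (intro measurable_Pair measurable_restrict_subset measurable_component_singleton) auto
  have h[measurable]: "?h \<in> borel_measurable (PiM {0..<Suc n} M)"
    using measurable_compose[OF 1 f] by simp
  have "(\<integral>\<^sup>+\<omega>. ?h \<omega> \<partial>PF.lim) = (\<integral>\<^sup>+\<omega>. ?h (restrict \<omega> {0..<Suc n}) \<partial>PF.lim)"
    by (intro nn_integral_cong) (simp add: Int_absorb1)
  also have "\<dots> = (\<integral>\<^sup>+\<omega>. ?h \<omega> \<partial>C 0 (Suc n) (\<lambda>_. undefined))"
    by (rule nn_integral_lim_restrict[OF h])
  also have "\<dots> = (\<integral>\<^sup>+\<omega>. \<integral>\<^sup>+\<omega>'. ?h \<omega>' \<partial>eP n \<omega> \<partial>C 0 n (\<lambda>_. undefined))"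
    using measurable_eP[of n] h
    by (simp add: nn_integral_bind[where B = "PiM {0..<Suc n} M"] measurable_cong_sets[OF sets_C refl])
  also have "\<dots> = (\<integral>\<^sup>+\<omega>. (\<integral>\<^sup>+y. f \<omega> y \<partial>P n \<omega>) \<partial>C 0 n (\<lambda>_. undefined))"
  proof (intro nn_integral_cong)
    fix \<omega> assume "\<omega> \<in> space (C 0 n (\<lambda>_. undefined))"
    then have \<omega>: "\<omega> \<in> space (PiM {0..<n} M)"
      by (simp add: space_C)
    have "(fun_upd \<omega> n y) n = y \<and> restrict (fun_upd \<omega> n y) {0..<n} = \<omega>" for y
      using \<omega> by (auto simp: space_PiM PiE_iff extensional_def fun_eq_iff)
    then show "(\<integral>\<^sup>+\<omega>'. ?h \<omega>' \<partial>eP n \<omega>) = (\<integral>\<^sup>+y. f \<omega> y \<partial>P n \<omega>)"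
      by (simp add: nn_integral_eP[OF \<omega> h])
  qed
  also have "\<dots> = (\<integral>\<^sup>+\<omega>. (\<integral>\<^sup>+y. f (restrict \<omega> {0..<n}) y \<partial>P n (restrict \<omega> {0..<n})) \<partial>PF.lim)"
    by (rule nn_integral_lim_restrict[symmetric], rule nn_integral_measurable_subprob_algebra2[OF f P])
  finally show ?thesis .
qed

section \<open>The information-state process under a policy\<close>

text \<open>
  The data under which every policy has a trajectory law and a finite cost, and any bounded Borel
  function can be compared with that cost.
\<close>
locale filtered_mdp =
  fixes M :: "('x, 'u, 'e, 'v) obs_model"
    and c :: "'x \<times> 'u \<Rightarrow> real" and \<alpha> C\<^sub>c :: real
  assumes model: "wf_obs_model M"
    and discount: "0 < \<alpha>" "\<alpha> < 1"
    and c_bounded: "\<And>x u. x \<in> space (stX M) \<Longrightarrow> u \<in> space (actU M) \<Longrightarrow> \<bar>c (x, u)\<bar> \<le> C\<^sub>c"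
    and g_measurable:
      "(\<lambda>(I, u). filtered_cost c I u) \<in> borel_measurable (info_space M \<Otimes>\<^sub>M actU M)"
    and K_kernel:
      "(\<lambda>(I, u). info_kernel M I u) \<in>
         info_space M \<Otimes>\<^sub>M actU M \<rightarrow>\<^sub>M prob_algebra (info_space M)"
begin

abbreviation "\<I> \<equiv> info_space M"
abbreviation "\<U> \<equiv> actU M"
abbreviation "\<S> \<equiv> \<I> \<Otimes>\<^sub>M \<U>"
abbreviation "hist t \<equiv> PiM {0..<t::nat} (\<lambda>_. \<S>)"

lemma prob_space_info_kernel:
  assumes "I \<in> space \<I>" "u \<in> space \<U>"
  shows "prob_space (info_kernel M I u)" "sets (info_kernel M I u) = sets \<I>"
    "space (info_kernel M I u) = space \<I>"
proof -
  show "prob_space (info_kernel M I u)" and sets: "sets (info_kernel M I u) = sets \<I>"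
    using measurable_space[OF K_kernel, of "(I, u)"] assms
    by (simp_all add: space_pair_measure space_prob_algebra)
  show "space (info_kernel M I u) = space \<I>"
    by (rule sets_eq_imp_space_eq[OF sets])
qed

text \<open>
  The transition law is a finite mixture of point masses, one per class. This finiteness is what later
  makes measurable selection avoidable.
\<close>
lemma nn_integral_info_kernel:
  assumes I: "I \<in> space \<I>" and u: "u \<in> space \<U>" and h: "h \<in> borel_measurable \<I>"
  shows "(\<integral>\<^sup>+I'. h I' \<partial>info_kernel M I u) =
           (\<Sum>k\<in>class_idx M. ennreal (class_prob M k (snd I) u) * h (k, filterPhi M k (snd I) u))"
proof -
  have "snd I \<in> space (prob_algebra (stX M))"
    using I by (auto simp: space_info_space)
  then have "(\<lambda>k. (k, filterPhi M k (snd I) u))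
      \<in> point_measure (class_idx M) (\<lambda>k. ennreal (class_prob M k (snd I) u)) \<rightarrow>\<^sub>M \<I>"
    using filterPhi_in_info_space[OF model _ u]
    by (intro measurableI) (auto simp: space_point_measure sets_point_measure)
  then show ?thesis
    using h unfolding info_kernel_def
    by (simp add: nn_integral_distr nn_integral_point_measure_finite class_idx_def)
qed

lemma sum_class_prob:
  assumes "I \<in> space \<I>" "u \<in> space \<U>"
  shows "(\<Sum>k\<in>class_idx M. ennreal (class_prob M k (snd I) u)) = 1"
proof -
  interpret prob_space "info_kernel M I u"
    by (rule prob_space_info_kernel[OF assms])
  show ?thesis
    using nn_integral_info_kernel[OF assms, of "\<lambda>_. 1"] emeasure_space_1 by simp
qed

lemma g_bounded:
  assumes I: "I \<in> space \<I>" and u: "u \<in> space \<U>"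
  shows "\<bar>filtered_cost c I u\<bar> \<le> C\<^sub>c"
proof -
  have "snd I \<in> space (prob_algebra (stX M))"
    using I by (auto simp: space_info_space)
  then have "prob_space (snd I)" "sets (snd I) = sets (stX M)"
    by (simp_all add: space_prob_algebra)
  then interpret prob_space "snd I" by simp
  have sp: "space (snd I) = space (stX M)"
    using \<open>sets (snd I) = _\<close> by (rule sets_eq_imp_space_eq)
  obtain x where "x \<in> space (stX M)"
    using not_empty sp by auto
  then have "C\<^sub>c \<ge> 0"
    using c_bounded[OF _ u, of x] by simp
  have "\<bar>\<integral>x. c (x, u) \<partial>snd I\<bar> \<le> (\<integral>x. \<bar>c (x, u)\<bar> \<partial>snd I)"
    by (rule integral_abs_bound)
  also have "\<dots> \<le> (\<integral>x. C\<^sub>c \<partial>snd I)"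
    using c_bounded[OF _ u] \<open>C\<^sub>c \<ge> 0\<close> by (intro integral_mono') (auto simp: sp)
  finally show ?thesis
    by (simp add: filtered_cost_def prob_space)
qed

lemma info_space_nonempty: "space \<I> \<noteq> {}"
proof -
  have cover: "(\<Union>j\<in>{1..obs_r M + 1}. obs_class M j) = space (stX M)"
    using model unfolding wf_obs_model_def by (elim conjE)
  have "space (stX M) \<noteq> {}"
    using model unfolding wf_obs_model_def by (elim conjE)
  then obtain x where x: "x \<in> space (stX M)" by blast
  have rho: "\<forall>k\<in>class_idx M. rho M k \<in> space (prob_algebra (stX M)) \<and>
      measure (rho M k) (obs_class M k) = 1"
    using model unfolding wf_obs_model_def by (elim conjE)
  obtain j where "j \<in> {1..obs_r M + 1}" "x \<in> obs_class M j"
    using x unfolding cover[symmetric] by (rule UN_E)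
  then have j: "j \<in> class_idx M"
    by (auto simp: class_idx_def)
  then have "(j, rho M j) \<in> space \<I>"
    using rho by (simp add: space_info_space)
  then show ?thesis by blast
qed

lemma action_space_nonempty: "space \<U> \<noteq> {}"
  using model unfolding wf_obs_model_def by (elim conjE)

end

locale policy_run = filtered_mdp M c \<alpha> C\<^sub>c
  for M :: "('x, 'u, 'e, 'v) obs_model" and c :: "'x \<times> 'u \<Rightarrow> real" and \<alpha> C\<^sub>c :: real +
  fixes \<gamma> :: "nat \<Rightarrow> (nat \<Rightarrow> (nat \<times> 'x measure) \<times> 'u) \<times> (nat \<times> 'x measure) \<Rightarrow> 'u measure"
    and I\<^sub>0 :: "nat \<times> 'x measure"
  assumes policy: "\<gamma> \<in> policies M" and start: "I\<^sub>0 \<in> space (info_space M)"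
begin

sublocale IT: Ionescu_Tulcea "step_law M \<gamma> I\<^sub>0" "\<lambda>_. \<S>"
  by (rule Ionescu_Tulcea_step_law[OF model start policy K_kernel])

abbreviation "\<P> \<equiv> traj_law M \<gamma> I\<^sub>0"

lemma traj_law_eq: "\<P> = IT.PF.lim"
  by (simp add: traj_law_def)

sublocale traj: prob_space \<P>
  unfolding traj_law_eq by (rule IT.prob_space_lim)

lemma sets_traj_law [measurable_cong]: "sets \<P> = sets (PiM UNIV (\<lambda>_. \<S>))"
  by (simp add: traj_law_eq)

lemma space_traj_law: "space \<P> = space (PiM UNIV (\<lambda>_. \<S>))"
  by (rule sets_eq_imp_space_eq[OF sets_traj_law])

lemma measurable_coordinate [measurable]: "(\<lambda>\<omega>. \<omega> t) \<in> \<P> \<rightarrow>\<^sub>M \<S>"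
  by measurable

lemma coordinate_in_space:
  assumes "\<omega> \<in> space \<P>"
  shows "\<omega> t \<in> space \<S>" "fst (\<omega> t) \<in> space \<I>" "snd (\<omega> t) \<in> space \<U>"
  using measurable_space[OF measurable_coordinate assms, of t] by (auto simp: space_pair_measure)

text \<open>
  The first of the two stages of \<open>step_law\<close>: the law of \<open>I\<^sub>t\<close> given the past, before the
  action is drawn.
\<close>
definition state_law where
  "state_law t \<omega> = (if t = 0 then return \<I> I\<^sub>0
     else info_kernel M (fst (\<omega> (t - 1))) (snd (\<omega> (t - 1))))"

lemma state_law:
  assumes "\<omega> \<in> space (hist t)"
  shows "prob_space (state_law t \<omega>)" "sets (state_law t \<omega>) = sets \<I>"
    "space (state_law t \<omega>) = space \<I>"
proof -
  have *: "prob_space (state_law t \<omega>) \<and> sets (state_law t \<omega>) = sets \<I>"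
  proof (cases t)
    case 0
    then show ?thesis using start by (simp add: state_law_def prob_space_return)
  next
    case (Suc s)
    have "\<omega> s \<in> space \<S>"
      using measurable_space[OF measurable_component_singleton assms, of s] Suc by simp
    then show ?thesis
      using prob_space_info_kernel[of "fst (\<omega> s)" "snd (\<omega> s)"] Suc
      by (auto simp: state_law_def space_pair_measure)
  qed
  then show "prob_space (state_law t \<omega>)" "sets (state_law t \<omega>) = sets \<I>"
    "space (state_law t \<omega>) = space \<I>"
    using sets_eq_imp_space_eq by blast+
qed

lemma policy_measurable [measurable]: "\<gamma> t \<in> hist t \<Otimes>\<^sub>M \<I> \<rightarrow>\<^sub>M prob_algebra \<U>"
  using policy by (simp add: policies_def)

lemma policy_law:
  assumes "\<omega> \<in> space (hist t)" "I \<in> space \<I>"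
  shows "prob_space (\<gamma> t (\<omega>, I))" "sets (\<gamma> t (\<omega>, I)) = sets \<U>" "space (\<gamma> t (\<omega>, I)) = space \<U>"
proof -
  show "prob_space (\<gamma> t (\<omega>, I))" and sets: "sets (\<gamma> t (\<omega>, I)) = sets \<U>"
    using measurable_space[OF policy_measurable, of "(\<omega>, I)" t] assms
    by (simp_all add: space_pair_measure space_prob_algebra)
  show "space (\<gamma> t (\<omega>, I)) = space \<U>"
    by (rule sets_eq_imp_space_eq[OF sets])
qed

lemma nn_integral_step_law:
  assumes \<omega>: "\<omega> \<in> space (hist t)" and f[measurable]: "f \<in> borel_measurable \<S>"
  shows "(\<integral>\<^sup>+y. f y \<partial>step_law M \<gamma> I\<^sub>0 t \<omega>) =
         (\<integral>\<^sup>+I. \<integral>\<^sup>+u. f (I, u) \<partial>\<gamma> t (\<omega>, I) \<partial>state_law t \<omega>)"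
proof -
  note \<omega>[measurable]
  have "(\<lambda>I. distr (\<gamma> t (\<omega>, I)) \<S> (Pair I)) \<in> \<I> \<rightarrow>\<^sub>M prob_algebra \<S>"
    by (rule measurable_distr_prob_space2[where M = \<U>]) auto
  then have k: "(\<lambda>I. distr (\<gamma> t (\<omega>, I)) \<S> (Pair I)) \<in> state_law t \<omega> \<rightarrow>\<^sub>M subprob_algebra \<S>"
    by (simp add: measurable_cong_sets[OF state_law(2)[OF \<omega>] refl] measurable_prob_algebraD)
  have "(\<integral>\<^sup>+y. f y \<partial>step_law M \<gamma> I\<^sub>0 t \<omega>) =
        (\<integral>\<^sup>+I. \<integral>\<^sup>+y. f y \<partial>distr (\<gamma> t (\<omega>, I)) \<S> (Pair I) \<partial>state_law t \<omega>)"
    unfolding step_law_def state_law_def[symmetric] by (rule nn_integral_bind[OF f k])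
  also have "\<dots> = (\<integral>\<^sup>+I. \<integral>\<^sup>+u. f (I, u) \<partial>\<gamma> t (\<omega>, I) \<partial>state_law t \<omega>)"
  proof (intro nn_integral_cong)
    fix I assume "I \<in> space (state_law t \<omega>)"
    then have I: "I \<in> space \<I>" using state_law(3)[OF \<omega>] by simp
    have "Pair I \<in> \<gamma> t (\<omega>, I) \<rightarrow>\<^sub>M \<S>"
      using I by (simp add: measurable_cong_sets[OF policy_law(2)[OF \<omega> I] refl])
    then show "(\<integral>\<^sup>+y. f y \<partial>distr (\<gamma> t (\<omega>, I)) \<S> (Pair I)) = (\<integral>\<^sup>+u. f (I, u) \<partial>\<gamma> t (\<omega>, I))"
      by (simp add: nn_integral_distr)
  qed
  finally show ?thesis .
qed

lemma restrict_in_hist: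
  "\<omega> \<in> space \<P> \<Longrightarrow> restrict \<omega> {0..<t} \<in> space (hist t)"
  by (auto simp: space_traj_law space_PiM PiE_iff)

text \<open>
  Conditioning on the past at time \<open>t\<close>, with the two stages of the step written as an iterated
  integral: first the new state, then the action.
\<close>
lemma nn_integral_traj_step:
  assumes f: "(\<lambda>(\<omega>, y). f \<omega> y) \<in> borel_measurable (hist t \<Otimes>\<^sub>M \<S>)"
  shows "(\<integral>\<^sup>+\<omega>. f (restrict \<omega> {0..<t}) (\<omega> t) \<partial>\<P>) =
         (\<integral>\<^sup>+\<omega>. \<integral>\<^sup>+I. \<integral>\<^sup>+u. f (restrict \<omega> {0..<t}) (I, u) \<partial>\<gamma> t (restrict \<omega> {0..<t}, I)
            \<partial>state_law t (restrict \<omega> {0..<t}) \<partial>\<P>)"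
  unfolding traj_law_eq IT.nn_integral_lim_step[OF f]
  unfolding traj_law_eq[symmetric]
proof (intro nn_integral_cong nn_integral_step_law)
  fix \<omega> assume "\<omega> \<in> space \<P>"
  then show \<omega>: "restrict \<omega> {0..<t} \<in> space (hist t)"
    by (rule restrict_in_hist)
  show "f (restrict \<omega> {0..<t}) \<in> borel_measurable \<S>"
    using measurable_Pair2[OF f \<omega>] by simp
qed

text \<open>
  An integrand that ignores the action at time \<open>t\<close> does not feel the policy at time \<open>t\<close>, whose kernel
  has total mass one.
\<close>
lemma nn_integral_next_state:
  assumes f: "(\<lambda>(\<omega>, I). f \<omega> I) \<in> borel_measurable (hist t \<Otimes>\<^sub>M \<I>)"
  shows "(\<integral>\<^sup>+\<omega>. f (restrict \<omega> {0..<t}) (fst (\<omega> t)) \<partial>\<P>) =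
         (\<integral>\<^sup>+\<omega>. \<integral>\<^sup>+I. f (restrict \<omega> {0..<t}) I \<partial>state_law t (restrict \<omega> {0..<t}) \<partial>\<P>)"
proof -
  have "(\<lambda>x. (fst x, fst (snd x))) \<in> hist t \<Otimes>\<^sub>M \<S> \<rightarrow>\<^sub>M hist t \<Otimes>\<^sub>M \<I>"
    by measurable
  from measurable_compose[OF this f]
  have "(\<lambda>(\<omega>, y). f \<omega> (fst y)) \<in> borel_measurable (hist t \<Otimes>\<^sub>M \<S>)"
    by (simp add: case_prod_beta')
  from nn_integral_traj_step[OF this]
  have "(\<integral>\<^sup>+\<omega>. f (restrict \<omega> {0..<t}) (fst (\<omega> t)) \<partial>\<P>) =
    (\<integral>\<^sup>+\<omega>. \<integral>\<^sup>+I. \<integral>\<^sup>+u. f (restrict \<omega> {0..<t}) I \<partial>\<gamma> t (restrict \<omega> {0..<t}, I)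
            \<partial>state_law t (restrict \<omega> {0..<t}) \<partial>\<P>)"
    by simp
  also have "\<dots> = (\<integral>\<^sup>+\<omega>. \<integral>\<^sup>+I. f (restrict \<omega> {0..<t}) I \<partial>state_law t (restrict \<omega> {0..<t}) \<partial>\<P>)"
  proof (intro nn_integral_cong)
    fix \<omega> I assume "\<omega> \<in> space \<P>" and I: "I \<in> space (state_law t (restrict \<omega> {0..<t}))"
    then have \<omega>: "restrict \<omega> {0..<t} \<in> space (hist t)"
      by (intro restrict_in_hist)
    interpret U: prob_space "\<gamma> t (restrict \<omega> {0..<t}, I)"
      using policy_law(1)[OF \<omega>] I state_law(3)[OF \<omega>] by simp
    show "(\<integral>\<^sup>+u. f (restrict \<omega> {0..<t}) I \<partial>\<gamma> t (restrict \<omega> {0..<t}, I)) = f (restrict \<omega> {0..<t}) I"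
      by (simp add: U.emeasure_space_1)
  qed
  finally show ?thesis .
qed

lemma nn_integral_initial_state:
  assumes h: "h \<in> borel_measurable \<I>"
  shows "(\<integral>\<^sup>+\<omega>. h (fst (\<omega> 0)) \<partial>\<P>) = h I\<^sub>0"
proof -
  have "(\<integral>\<^sup>+\<omega>. h (fst (\<omega> 0)) \<partial>\<P>) = (\<integral>\<^sup>+\<omega>. \<integral>\<^sup>+I. h I \<partial>return \<I> I\<^sub>0 \<partial>\<P>)"
    using nn_integral_next_state[of "\<lambda>_. h" 0] h by (simp add: state_law_def)
  then show ?thesis
    using h start by (simp add: nn_integral_return traj.emeasure_space_1)
qed

lemma distr_initial_state: "distr \<P> \<I> (\<lambda>\<omega>. fst (\<omega> 0)) = return \<I> I\<^sub>0"
proof (rule measure_eqI)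
  fix A assume "A \<in> sets (distr \<P> \<I> (\<lambda>\<omega>. fst (\<omega> 0)))"
  then have [measurable]: "A \<in> sets \<I>" by simp
  have "emeasure (distr \<P> \<I> (\<lambda>\<omega>. fst (\<omega> 0))) A =
      (\<integral>\<^sup>+I. indicator A I \<partial>distr \<P> \<I> (\<lambda>\<omega>. fst (\<omega> 0)))"
    by simp
  also have "\<dots> = (\<integral>\<^sup>+\<omega>. indicator A (fst (\<omega> 0)) \<partial>\<P>)"
    by (subst nn_integral_distr) auto
  also have "\<dots> = emeasure (return \<I> I\<^sub>0) A"
    by (subst nn_integral_initial_state) auto
  finally show "emeasure (distr \<P> \<I> (\<lambda>\<omega>. fst (\<omega> 0))) A = emeasure (return \<I> I\<^sub>0) A" .
qed simp

lemma distr_next_state: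
  "distr \<P> \<I> (\<lambda>\<omega>. fst (\<omega> (Suc t))) = \<P> \<bind> (\<lambda>\<omega>. info_kernel M (fst (\<omega> t)) (snd (\<omega> t)))"
proof (rule measure_eqI)
  have K: "(\<lambda>\<omega>. info_kernel M (fst (\<omega> t)) (snd (\<omega> t))) \<in> \<P> \<rightarrow>\<^sub>M prob_algebra \<I>"
    using measurable_compose[OF measurable_coordinate K_kernel] by (simp add: case_prod_beta')
  have P: "\<P> \<in> space (prob_algebra \<P>)"
    by (simp add: space_prob_algebra traj.prob_space_axioms)
  show "sets (distr \<P> \<I> (\<lambda>\<omega>. fst (\<omega> (Suc t)))) =
      sets (\<P> \<bind> (\<lambda>\<omega>. info_kernel M (fst (\<omega> t)) (snd (\<omega> t))))"
    by (simp add: sets_bind'[OF P K])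
  fix A assume "A \<in> sets (distr \<P> \<I> (\<lambda>\<omega>. fst (\<omega> (Suc t))))"
  then have A[measurable]: "A \<in> sets \<I>" by simp
  have "emeasure (distr \<P> \<I> (\<lambda>\<omega>. fst (\<omega> (Suc t)))) A =
      (\<integral>\<^sup>+I. indicator A I \<partial>distr \<P> \<I> (\<lambda>\<omega>. fst (\<omega> (Suc t))))"
    by simp
  also have "\<dots> = (\<integral>\<^sup>+\<omega>. indicator A (fst (\<omega> (Suc t))) \<partial>\<P>)"
    by (subst nn_integral_distr) auto
  also have "\<dots> = (\<integral>\<^sup>+\<omega>. \<integral>\<^sup>+I. indicator A I \<partial>info_kernel M (fst (\<omega> t)) (snd (\<omega> t)) \<partial>\<P>)"
    using nn_integral_next_state[of "\<lambda>_ I. indicator A I" "Suc t"] by (simp add: state_law_def)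
  also have "\<dots> = (\<integral>\<^sup>+\<omega>. emeasure (info_kernel M (fst (\<omega> t)) (snd (\<omega> t))) A \<partial>\<P>)"
    using A by (intro nn_integral_cong) (simp add: coordinate_in_space prob_space_info_kernel)
  also have "\<dots> = emeasure (\<P> \<bind> (\<lambda>\<omega>. info_kernel M (fst (\<omega> t)) (snd (\<omega> t)))) A"
    by (rule emeasure_bind_prob_algebra[OF P K A, symmetric])
  finally show "emeasure (distr \<P> \<I> (\<lambda>\<omega>. fst (\<omega> (Suc t)))) A =
      emeasure (\<P> \<bind> (\<lambda>\<omega>. info_kernel M (fst (\<omega> t)) (snd (\<omega> t)))) A" .
qed

end

section \<open>Policies driven by the observed class labels\<close>

text \<open>
  The class labels observed at times \<open>1, \<dots>, t\<close>, latest first. The label at time \<open>0\<close> is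
  omitted because the initial state is fixed. The state at time \<open>t\<close> is a separate argument, since a
  policy kernel receives it separately from the coordinates before \<open>t\<close>.
\<close>
primrec labels :: "nat \<Rightarrow> (nat \<Rightarrow> (nat \<times> 'b) \<times> 'u) \<Rightarrow> nat \<times> 'b \<Rightarrow> nat list" where
  "labels 0 \<omega> I = []"
| "labels (Suc t) \<omega> I = fst I # labels t \<omega> (fst (\<omega> t))"

text \<open>
  The information state that the filter reaches from \<open>I\<^sub>0\<close> when the labels in the list are observed
  and every action is chosen by the selector \<open>s\<close>.
\<close>
primrec replay ::
  "('x, 'u, 'e, 'v) obs_model \<Rightarrow> (nat \<times> 'x measure \<Rightarrow> 'u) \<Rightarrow> nat \<times> 'x measure \<Rightarrow>
   nat list \<Rightarrow> nat \<times> 'x measure" where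
  "replay M s I\<^sub>0 [] = I\<^sub>0"
| "replay M s I\<^sub>0 (k # ls) =
     (k, filterPhi M k (snd (replay M s I\<^sub>0 ls)) (s (replay M s I\<^sub>0 ls)))"

text \<open>
  The selector is applied to the replayed state instead of the actual one. The two agree almost surely,
  but only the replayed state is a function of discrete data, hence a measurable choice for every
  \<open>s\<close>.
\<close>
definition replay_policy ::
  "('x, 'u, 'e, 'v) obs_model \<Rightarrow> (nat \<times> 'x measure \<Rightarrow> 'u) \<Rightarrow> nat \<times> 'x measure \<Rightarrow>
   nat \<Rightarrow> (nat \<Rightarrow> (nat \<times> 'x measure) \<times> 'u) \<times> (nat \<times> 'x measure) \<Rightarrow> 'u measure" where
  "replay_policy M s I\<^sub>0 t = (\<lambda>(\<omega>, I). return (actU M) (s (replay M s I\<^sub>0 (labels t \<omega> I))))"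

lemma labels_restrict: "t \<le> n \<Longrightarrow> labels t (restrict \<omega> {0..<n}) I = labels t \<omega> I"
  by (induction t arbitrary: I) auto

context filtered_mdp
begin

lemma measurable_label [measurable]: "fst \<in> \<I> \<rightarrow>\<^sub>M count_space UNIV"
proof -
  have "fst \<in> count_space (class_idx M) \<Otimes>\<^sub>M prob_algebra (stX M) \<rightarrow>\<^sub>M count_space UNIV"
    by (rule measurable_compose[OF measurable_fst]) simp
  then show ?thesis
    unfolding info_space_def by (rule measurable_restrict_space1)
qed

lemma measurable_labels:
  assumes "t \<le> n"
  shows "(\<lambda>p. labels t (fst p) (snd p)) \<in> hist n \<Otimes>\<^sub>M \<I> \<rightarrow>\<^sub>M count_space UNIV"
  using assms
proof (induction t)
  case (Suc t)
  have [measurable]: "(\<lambda>\<omega>. \<omega> t) \<in> hist n \<rightarrow>\<^sub>M \<S>"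
    using Suc.prems by (intro measurable_component_singleton) simp
  have "(\<lambda>p. (fst p, fst (fst p t))) \<in> hist n \<Otimes>\<^sub>M \<I> \<rightarrow>\<^sub>M hist n \<Otimes>\<^sub>M \<I>"
    by measurable
  from measurable_compose[OF this Suc.IH] Suc.prems
  have L: "(\<lambda>p. labels t (fst p) (fst (fst p t))) \<in> hist n \<Otimes>\<^sub>M \<I> \<rightarrow>\<^sub>M count_space UNIV"
    by simp
  have "(\<lambda>p. fst (snd p)) \<in> hist n \<Otimes>\<^sub>M \<I> \<rightarrow>\<^sub>M count_space UNIV"
    by (rule measurable_compose[OF measurable_snd measurable_label])
  then have "(\<lambda>p. fst (snd p) # ls) \<in> hist n \<Otimes>\<^sub>M \<I> \<rightarrow>\<^sub>M count_space UNIV" for ls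
    by (rule measurable_compose) simp
  from measurable_compose_countable[OF this L] show ?case
    by simp
qed simp

text \<open>
  The countable set of label lists is discrete, so a function of the list and the state can be patched
  together from its sections.
\<close>
lemma measurable_labels_compose:
  assumes "\<And>ls. \<phi> ls \<in> \<I> \<rightarrow>\<^sub>M N" "t \<le> n"
  shows "(\<lambda>(\<omega>, I). \<phi> (labels t \<omega> I) I) \<in> hist n \<Otimes>\<^sub>M \<I> \<rightarrow>\<^sub>M N"
  using measurable_compose_countable[OF measurable_compose[OF measurable_snd assms(1)]
      measurable_labels[OF assms(2)]]
  by (simp add: case_prod_beta')

end

text \<open>
  The process run by the replay policy of a selector. The selector returns an action off the
  information space as well, where \<open>replay\<close> may end up on lists with entries outside
  \<open>class_idx M\<close>: the policy kernel is then a probability for each fixed label list, and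
  its measurability can be checked list by list.
\<close>
locale selected_run = filtered_mdp M c \<alpha> C\<^sub>c
  for M :: "('x, 'u, 'e, 'v) obs_model" and c :: "'x \<times> 'u \<Rightarrow> real" and \<alpha> C\<^sub>c :: real +
  fixes s :: "nat \<times> 'x measure \<Rightarrow> 'u" and I\<^sub>0 :: "nat \<times> 'x measure"
  assumes s: "\<And>I. s I \<in> space (actU M)" and start_state: "I\<^sub>0 \<in> space (info_space M)"
begin

abbreviation "state \<equiv> replay M s I\<^sub>0"

lemma state_in_space: "ls \<in> lists (class_idx M) \<Longrightarrow> state ls \<in> space \<I>"
proof (induction ls)
  case (Cons k ls)
  then have "snd (state ls) \<in> space (prob_algebra (stX M))"
    by (auto simp: space_info_space)
  with Cons.prems show ?case
    using filterPhi_in_info_space[OF model _ s] by simp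
qed (simp add: start_state)

lemma replay_policy_in_policies: "replay_policy M s I\<^sub>0 \<in> policies M"
proof -
  have "replay_policy M s I\<^sub>0 t \<in> hist t \<Otimes>\<^sub>M \<I> \<rightarrow>\<^sub>M prob_algebra \<U>" for t
    unfolding replay_policy_def
    by (rule measurable_labels_compose[where \<phi> = "\<lambda>ls _. return \<U> (s (state ls))"])
      (auto simp: space_prob_algebra prob_space_return s)
  then show ?thesis
    by (simp add: policies_def)
qed

sublocale policy_run M c \<alpha> C\<^sub>c "replay_policy M s I\<^sub>0" I\<^sub>0
  by unfold_locales (rule replay_policy_in_policies, rule start_state)

text \<open>
  The action is a deterministic function of the labels, so it may be substituted under the expectation.
  Both sides become the same integral over the past and the new state once the action, drawn from a
  point mass, is integrated out.
\<close>
lemma nn_integral_action: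
  assumes \<phi>: "\<And>ls. \<phi> ls \<in> borel_measurable \<S>"
  shows "(\<integral>\<^sup>+\<omega>. \<phi> (labels t \<omega> (fst (\<omega> t))) (\<omega> t) \<partial>\<P>) =
         (\<integral>\<^sup>+\<omega>. \<phi> (labels t \<omega> (fst (\<omega> t))) (fst (\<omega> t), s (state (labels t \<omega> (fst (\<omega> t))))) \<partial>\<P>)"
proof -
  define r where "r \<omega> = restrict \<omega> {0..<t}" for \<omega> :: "nat \<Rightarrow> (nat \<times> 'x measure) \<times> 'u"
  define h where "h ls I = \<phi> ls (I, s (state ls))" for ls I
  have "(\<lambda>I. (I, s (state ls))) \<in> \<I> \<rightarrow>\<^sub>M \<S>" for ls
    using s by simp
  then have h: "h ls \<in> borel_measurable \<I>" for ls
    unfolding h_def[abs_def] by (rule measurable_compose[OF _ \<phi>])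
  have 1: "(\<lambda>p. labels t (fst p) (fst (snd p))) \<in> hist t \<Otimes>\<^sub>M \<S> \<rightarrow>\<^sub>M count_space UNIV"
    using measurable_compose[of "\<lambda>p. (fst p, fst (snd p))" "hist t \<Otimes>\<^sub>M \<S>" "hist t \<Otimes>\<^sub>M \<I>",
        OF _ measurable_labels[OF order_refl]] by simp
  have f: "(\<lambda>(\<omega>, y). \<phi> (labels t \<omega> (fst y)) y) \<in> borel_measurable (hist t \<Otimes>\<^sub>M \<S>)"
    using measurable_compose_countable[OF measurable_compose[OF measurable_snd \<phi>] 1]
    by (simp add: case_prod_beta')
  have "(\<integral>\<^sup>+\<omega>. \<phi> (labels t \<omega> (fst (\<omega> t))) (\<omega> t) \<partial>\<P>) =
      (\<integral>\<^sup>+\<omega>. \<phi> (labels t (r \<omega>) (fst (\<omega> t))) (\<omega> t) \<partial>\<P>)"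
    by (simp add: r_def labels_restrict)
  also have "\<dots> = (\<integral>\<^sup>+\<omega>. \<integral>\<^sup>+I. \<integral>\<^sup>+u. \<phi> (labels t (r \<omega>) I) (I, u)
      \<partial>replay_policy M s I\<^sub>0 t (r \<omega>, I) \<partial>state_law t (r \<omega>) \<partial>\<P>)"
    unfolding r_def using nn_integral_traj_step[OF f] by simp
  also have "\<dots> = (\<integral>\<^sup>+\<omega>. \<integral>\<^sup>+I. h (labels t (r \<omega>) I) I \<partial>state_law t (r \<omega>) \<partial>\<P>)"
  proof (intro nn_integral_cong)
    fix \<omega> I assume "\<omega> \<in> space \<P>" and "I \<in> space (state_law t (r \<omega>))"
    then have I: "I \<in> space \<I>"
      using state_law(3)[OF restrict_in_hist] by (simp add: r_def)
    have "(\<lambda>u. \<phi> ls (I, u)) \<in> borel_measurable \<U>" for ls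
      using I \<phi> by (intro measurable_compose[OF _ \<phi>]) simp
    then show "(\<integral>\<^sup>+u. \<phi> (labels t (r \<omega>) I) (I, u) \<partial>replay_policy M s I\<^sub>0 t (r \<omega>, I)) =
        h (labels t (r \<omega>) I) I"
      by (simp add: replay_policy_def h_def nn_integral_return s)
  qed
  also have "\<dots> = (\<integral>\<^sup>+\<omega>. h (labels t (r \<omega>) (fst (\<omega> t))) (fst (\<omega> t)) \<partial>\<P>)"
    unfolding r_def
    by (rule nn_integral_next_state[where f = "\<lambda>\<omega> I. h (labels t \<omega> I) I",
          OF measurable_labels_compose[OF h order_refl], symmetric])
  also have "\<dots> = (\<integral>\<^sup>+\<omega>. h (labels t \<omega> (fst (\<omega> t))) (fst (\<omega> t)) \<partial>\<P>)"
    by (simp add: r_def labels_restrict)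
  finally show ?thesis
    by (simp add: h_def)
qed

text \<open>
  The actual state equals the replayed one almost surely; stated here in the weak form in which a
  bound on the replayed states alone controls the expectation. Induction on \<open>t\<close>: integrating out the
  last transition turns \<open>h\<close> into the function \<open>\<phi>\<close> below, evaluated at an action given by the labels.
  At a replayed state this is an average of values of \<open>h\<close> at replayed states whose label list is
  longer by one, so it inherits the bound.
\<close>
lemma nn_integral_state_le:
  assumes "\<And>ls. h ls \<in> borel_measurable \<I>"
    and "\<And>ls. ls \<in> lists (class_idx M) \<Longrightarrow> h ls (state ls) \<le> B"
  shows "(\<integral>\<^sup>+\<omega>. h (labels t \<omega> (fst (\<omega> t))) (fst (\<omega> t)) \<partial>\<P>) \<le> B"
  using assms
proof (induction t arbitrary: h)
  case 0
  have "(\<integral>\<^sup>+\<omega>. h [] (fst (\<omega> 0)) \<partial>\<P>) = h [] (state [])"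
    using nn_integral_initial_state[OF 0(1)] by simp
  also have "\<dots> \<le> B"
    by (rule 0(2)) simp
  finally show ?case by simp
next
  case (Suc t)
  define \<phi> where "\<phi> ls y = (\<integral>\<^sup>+I'. h (fst I' # ls) I' \<partial>info_kernel M (fst y) (snd y))" for ls y
  define r where "r \<omega> = restrict \<omega> {0..<Suc t}" for \<omega> :: "nat \<Rightarrow> (nat \<times> 'x measure) \<times> 'u"
  have h': "(\<lambda>I'. h (fst I' # ls) I') \<in> borel_measurable \<I>" for ls
    by (rule measurable_compose_countable[OF Suc.prems(1) measurable_label])
  have \<phi>: "\<phi> ls \<in> borel_measurable \<S>" for ls
    using measurable_compose[OF measurable_prob_algebraD[OF K_kernel]
        nn_integral_measurable_subprob_algebra[OF h']]
    by (simp add: \<phi>_def[abs_def] case_prod_beta')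
  have "(\<integral>\<^sup>+\<omega>. h (labels (Suc t) \<omega> (fst (\<omega> (Suc t)))) (fst (\<omega> (Suc t))) \<partial>\<P>) =
      (\<integral>\<^sup>+\<omega>. h (labels (Suc t) (r \<omega>) (fst (\<omega> (Suc t)))) (fst (\<omega> (Suc t))) \<partial>\<P>)"
    by (simp only: r_def labels_restrict[OF order_refl])
  also have "\<dots> = (\<integral>\<^sup>+\<omega>. \<integral>\<^sup>+I. h (labels (Suc t) (r \<omega>) I) I \<partial>state_law (Suc t) (r \<omega>) \<partial>\<P>)"
    unfolding r_def
    by (rule nn_integral_next_state[where f = "\<lambda>\<omega> I. h (labels (Suc t) \<omega> I) I",
          OF measurable_labels_compose[OF Suc.prems(1) order_refl]])
  also have "\<dots> = (\<integral>\<^sup>+\<omega>. \<phi> (labels t \<omega> (fst (\<omega> t))) (\<omega> t) \<partial>\<P>)"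
    by (simp add: r_def state_law_def \<phi>_def labels_restrict)
  also have "\<dots> = (\<integral>\<^sup>+\<omega>. \<phi> (labels t \<omega> (fst (\<omega> t))) (fst (\<omega> t), s (state (labels t \<omega> (fst (\<omega> t))))) \<partial>\<P>)"
    by (rule nn_integral_action[OF \<phi>])
  also have "\<dots> \<le> B"
  proof (rule Suc.IH)
    show "(\<lambda>I. \<phi> ls (I, s (state ls))) \<in> borel_measurable \<I>" for ls
      using s by (intro measurable_compose[OF _ \<phi>]) simp
    fix ls assume ls: "ls \<in> lists (class_idx M)"
    let ?p = "\<lambda>k. ennreal (class_prob M k (snd (state ls)) (s (state ls)))"
    have "\<phi> ls (state ls, s (state ls)) = (\<Sum>k\<in>class_idx M. ?p k * h (k # ls) (state (k # ls)))"
      by (simp add: \<phi>_def nn_integral_info_kernel[OF state_in_space[OF ls] s h'])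
    also have "\<dots> \<le> (\<Sum>k\<in>class_idx M. ?p k * B)"
      using ls by (intro sum_mono mult_left_mono Suc.prems(2)) auto
    also have "\<dots> = B"
      by (simp add: sum_distrib_right[symmetric] sum_class_prob[OF state_in_space[OF ls] s])
    finally show "\<phi> ls (state ls, s (state ls)) \<le> B" .
  qed
  finally show ?case .
qed

end

section \<open>Action values and the Bellman operator\<close>

context filtered_mdp
begin

definition action_value :: "(nat \<times> 'x measure \<Rightarrow> real) \<Rightarrow> (nat \<times> 'x measure) \<times> 'u \<Rightarrow> real" where
  "action_value v y =
     filtered_cost c (fst y) (snd y) + \<alpha> * (\<integral>I'. v I' \<partial>info_kernel M (fst y) (snd y))"

text \<open>
  The one-step loss of an action measured against \<open>v\<close>, the negative of the advantage function of
  reinforcement learning.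
\<close>
definition gap :: "(nat \<times> 'x measure \<Rightarrow> real) \<Rightarrow> (nat \<times> 'x measure) \<times> 'u \<Rightarrow> real" where
  "gap v y = action_value v y - v (fst y)"

lemma kernel_integral_bounded:
  fixes v :: "nat \<times> 'x measure \<Rightarrow> real"
  assumes y: "y \<in> space \<S>" and v: "v \<in> borel_measurable \<I>"
    and bound: "\<And>I. I \<in> space \<I> \<Longrightarrow> \<bar>v I\<bar> \<le> B"
  shows "integrable (info_kernel M (fst y) (snd y)) v"
    and "\<bar>\<integral>I'. v I' \<partial>info_kernel M (fst y) (snd y)\<bar> \<le> B"
proof -
  let ?K = "info_kernel M (fst y) (snd y)"
  have y': "fst y \<in> space \<I>" "snd y \<in> space \<U>"
    using y by (auto simp: space_pair_measure)
  interpret K: prob_space ?K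
    by (rule prob_space_info_kernel(1)[OF y'])
  have v': "v \<in> borel_measurable ?K"
    using v by (simp add: measurable_cong_sets[OF prob_space_info_kernel(2)[OF y'] refl])
  show int: "integrable ?K v"
    using bound prob_space_info_kernel(3)[OF y']
    by (intro K.integrable_const_bound[where B = B] v') auto
  have "\<bar>\<integral>I'. v I' \<partial>?K\<bar> \<le> (\<integral>I'. \<bar>v I'\<bar> \<partial>?K)"
    by (rule integral_abs_bound)
  also have "\<dots> \<le> (\<integral>I'. B \<partial>?K)"
    using bound prob_space_info_kernel(3)[OF y'] int
    by (intro integral_mono integrable_abs) auto
  finally show "\<bar>\<integral>I'. v I' \<partial>?K\<bar> \<le> B"
    by (simp add: K.prob_space)
qed

lemma action_value_contraction:
  assumes y: "y \<in> space \<S>" and v: "v \<in> bdd_borel \<I>" and w: "w \<in> bdd_borel \<I>"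
    and d: "\<And>I. I \<in> space \<I> \<Longrightarrow> \<bar>v I - w I\<bar> \<le> d"
  shows "\<bar>action_value v y - action_value w y\<bar> \<le> \<alpha> * d"
proof -
  let ?K = "info_kernel M (fst y) (snd y)"
  obtain Bv Bw where B: "\<forall>I\<in>space \<I>. \<bar>v I\<bar> \<le> Bv" "\<forall>I\<in>space \<I>. \<bar>w I\<bar> \<le> Bw"
    using bdd_borelD(3)[OF v] bdd_borelD(3)[OF w] by blast
  have "integrable ?K v" "integrable ?K w"
    using B by (auto intro!: kernel_integral_bounded(1)[OF y] bdd_borelD(1) v w)
  then have "action_value v y - action_value w y = \<alpha> * (\<integral>I'. v I' - w I' \<partial>?K)"
    by (simp add: action_value_def algebra_simps)
  moreover have "\<bar>\<integral>I'. v I' - w I' \<partial>?K\<bar> \<le> d"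
    using d bdd_borelD(1)[OF v] bdd_borelD(1)[OF w]
    by (intro kernel_integral_bounded(2)[OF y]) auto
  ultimately show ?thesis
    using discount by (simp add: abs_mult)
qed

lemma action_value_bounded:
  assumes y: "y \<in> space \<S>" and v: "v \<in> bdd_borel \<I>"
    and B: "\<And>I. I \<in> space \<I> \<Longrightarrow> \<bar>v I\<bar> \<le> B"
  shows "\<bar>action_value v y\<bar> \<le> C\<^sub>c + \<alpha> * B"
proof -
  let ?i = "\<integral>I'. v I' \<partial>info_kernel M (fst y) (snd y)"
  have "\<bar>filtered_cost c (fst y) (snd y)\<bar> \<le> C\<^sub>c"
    using y by (intro g_bounded) (auto simp: space_pair_measure)
  moreover have "\<bar>\<alpha> * ?i\<bar> \<le> \<alpha> * B"
    using kernel_integral_bounded(2)[OF y bdd_borelD(1)[OF v] B] discount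
    by (simp add: abs_mult)
  ultimately show ?thesis
    unfolding action_value_def by linarith
qed

lemma kernel_integral_measurable:
  assumes "v \<in> bdd_borel \<I>"
  shows "(\<lambda>y. \<integral>I'. v I' \<partial>info_kernel M (fst y) (snd y)) \<in> borel_measurable \<S>"
  using measurable_compose[OF measurable_prob_algebraD[OF K_kernel]
      integral_measurable_subprob_algebra[OF bdd_borelD(1)[OF assms]]]
  by (simp add: case_prod_beta')

lemma action_value_measurable [measurable]:
  assumes "v \<in> bdd_borel \<I>"
  shows "action_value v \<in> borel_measurable \<S>"
proof -
  show ?thesis
    using g_measurable kernel_integral_measurable[OF assms] unfolding action_value_def[abs_def] by (simp add: case_prod_beta')
qed

lemma gap_measurable [measurable]:
  assumes "v \<in> bdd_borel \<I>"
  shows "gap v \<in> borel_measurable \<S>"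
  unfolding gap_def[abs_def]
  by (intro borel_measurable_diff action_value_measurable[OF assms]
      measurable_compose[OF measurable_fst bdd_borelD(1)[OF assms]])

lemma bellman_eq:
  "I \<in> space \<I> \<Longrightarrow> bellman M c \<alpha> v I = (INF u\<in>space \<U>. action_value v (I, u))"
  by (simp add: bellman_def action_value_def)

lemma bdd_below_action_value:
  assumes "v \<in> bdd_borel \<I>" "I \<in> space \<I>"
  shows "bdd_below ((\<lambda>u. action_value v (I, u)) ` space \<U>)"
proof -
  obtain B where B: "\<forall>I\<in>space \<I>. \<bar>v I\<bar> \<le> B"
    using bdd_borelD(3)[OF assms(1)] by blast
  have "- (C\<^sub>c + \<alpha> * B) \<le> action_value v (I, u)" if "u \<in> space \<U>" for u
    using action_value_bounded[of "(I, u)" v B] assms that B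
    by (fastforce simp: space_pair_measure)
  then show ?thesis
    by (auto intro!: bdd_belowI2)
qed

lemma bellman_le_action_value:
  assumes "v \<in> bdd_borel \<I>" "I \<in> space \<I>" "u \<in> space \<U>"
  shows "bellman M c \<alpha> v I \<le> action_value v (I, u)"
  unfolding bellman_eq[OF assms(2)]
  by (rule cINF_lower[OF bdd_below_action_value[OF assms(1,2)] assms(3)])

lemma near_optimal_action:
  assumes "v \<in> bdd_borel \<I>" "I \<in> space \<I>" "\<epsilon> > 0"
  shows "\<exists>u\<in>space \<U>. action_value v (I, u) < bellman M c \<alpha> v I + \<epsilon>"
  using cINF_less_iff[OF action_space_nonempty bdd_below_action_value[OF assms(1,2)],
      of "bellman M c \<alpha> v I + \<epsilon>"] assms(3)
  unfolding bellman_eq[OF assms(2)] by simp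

text \<open>
  By symmetry one inequality suffices. The infimum may not be attained, so an \<open>\<epsilon>\<close>-optimal action for
  one function is tested against the other.
\<close>
lemma bellman_contraction:
  assumes v: "v \<in> bdd_borel \<I>" and w: "w \<in> bdd_borel \<I>"
    and d: "\<And>I. I \<in> space \<I> \<Longrightarrow> \<bar>v I - w I\<bar> \<le> d" and I: "I \<in> space \<I>"
  shows "\<bar>bellman M c \<alpha> v I - bellman M c \<alpha> w I\<bar> \<le> \<alpha> * d"
proof -
  have "bellman M c \<alpha> v I \<le> bellman M c \<alpha> w I + \<alpha> * d"
    if v: "v \<in> bdd_borel \<I>" and w: "w \<in> bdd_borel \<I>"
      and d: "\<And>I. I \<in> space \<I> \<Longrightarrow> \<bar>v I - w I\<bar> \<le> d" for v w
  proof (rule field_le_epsilon)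
    fix \<epsilon> :: real assume "\<epsilon> > 0"
    then obtain u where u: "u \<in> space \<U>" "action_value w (I, u) < bellman M c \<alpha> w I + \<epsilon>"
      using near_optimal_action[OF w I] by blast
    have "\<bar>action_value v (I, u) - action_value w (I, u)\<bar> \<le> \<alpha> * d"
      using I u(1) d by (intro action_value_contraction v w) (simp_all add: space_pair_measure)
    with bellman_le_action_value[OF v I u(1)] u(2)
    show "bellman M c \<alpha> v I \<le> bellman M c \<alpha> w I + \<alpha> * d + \<epsilon>"
      by linarith
  qed
  from this[OF v w d] this[OF w v] d show ?thesis
    by (simp add: abs_le_iff abs_minus_commute)
qed

end

section \<open>The performance identity\<close>

context policy_run
begin

lemma integrable_traj:
  assumes "f \<in> borel_measurable \<S>" "\<And>y. y \<in> space \<S> \<Longrightarrow> \<bar>f y\<bar> \<le> (B :: real)"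
  shows "integrable \<P> (\<lambda>\<omega>. f (\<omega> t))"
  using assms coordinate_in_space(1)
  by (intro traj.integrable_const_bound[where B = B] measurable_compose[OF measurable_coordinate])
    auto

lemma abs_expectation_le:
  assumes "f \<in> borel_measurable \<S>" "\<And>y. y \<in> space \<S> \<Longrightarrow> \<bar>f y\<bar> \<le> (B :: real)"
  shows "\<bar>\<integral>\<omega>. f (\<omega> t) \<partial>\<P>\<bar> \<le> B" "(\<integral>\<omega>. \<bar>f (\<omega> t)\<bar> \<partial>\<P>) \<le> B"
proof -
  show *: "(\<integral>\<omega>. \<bar>f (\<omega> t)\<bar> \<partial>\<P>) \<le> B"
    using integrable_traj[OF assms] assms(2) coordinate_in_space(1)
    by (intro traj.integral_le_const) auto
  show "\<bar>\<integral>\<omega>. f (\<omega> t) \<partial>\<P>\<bar> \<le> B"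
    using integral_abs_bound[of \<P> "\<lambda>\<omega>. f (\<omega> t)"] * by linarith
qed

lemma integral_initial_state:
  fixes v :: "nat \<times> 'x measure \<Rightarrow> real"
  assumes v: "v \<in> bdd_borel \<I>"
  shows "(\<integral>\<omega>. v (fst (\<omega> 0)) \<partial>\<P>) = v I\<^sub>0"
proof -
  have "(\<integral>\<omega>. v (fst (\<omega> 0)) \<partial>\<P>) = (\<integral>I. v I \<partial>distr \<P> \<I> (\<lambda>\<omega>. fst (\<omega> 0)))"
    using bdd_borelD(1)[OF v] by (simp add: integral_distr)
  then show ?thesis
    using bdd_borelD(1)[OF v] start by (simp add: distr_initial_state integral_return)
qed

lemma integral_next_state:
  fixes v :: "nat \<times> 'x measure \<Rightarrow> real"
  assumes v: "v \<in> bdd_borel \<I>"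
  shows "(\<integral>\<omega>. v (fst (\<omega> (Suc t))) \<partial>\<P>) =
         (\<integral>\<omega>. \<integral>I. v I \<partial>info_kernel M (fst (\<omega> t)) (snd (\<omega> t)) \<partial>\<P>)"
proof -
  obtain B where B: "\<forall>I\<in>space \<I>. \<bar>v I\<bar> \<le> B"
    using bdd_borelD(3)[OF v] by blast
  have K: "(\<lambda>\<omega>. info_kernel M (fst (\<omega> t)) (snd (\<omega> t))) \<in> \<P> \<rightarrow>\<^sub>M subprob_algebra \<I>"
    using measurable_compose[OF measurable_coordinate measurable_prob_algebraD[OF K_kernel]]
    by (simp add: case_prod_beta')
  have "(\<integral>\<omega>. v (fst (\<omega> (Suc t))) \<partial>\<P>) = (\<integral>I. v I \<partial>distr \<P> \<I> (\<lambda>\<omega>. fst (\<omega> (Suc t))))"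
    using bdd_borelD(1)[OF v] by (simp add: integral_distr)
  also have "\<dots> = (\<integral>\<omega>. \<integral>I. v I \<partial>info_kernel M (fst (\<omega> t)) (snd (\<omega> t)) \<partial>\<P>)"
    unfolding distr_next_state
  proof (rule integral_bind[OF bdd_borelD(1)[OF v] _ K traj.finite_measure_axioms, where B' = 1])
    show "\<bar>v I\<bar> \<le> B" if "I \<in> space \<I>" for I
      using B that by blast
    show "AE \<omega> in \<P>. emeasure (info_kernel M (fst (\<omega> t)) (snd (\<omega> t)))
        (space (info_kernel M (fst (\<omega> t)) (snd (\<omega> t)))) \<le> ennreal 1"
      by (intro AE_I2)
        (simp add: coordinate_in_space prob_space.emeasure_space_1 prob_space_info_kernel(1))
  qed
  finally show ?thesis .
qed

text \<open>
  Let \<open>e t\<close> be the expectation of \<open>v\<close> at the state of time \<open>t\<close>. The expected gap is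
  \<open>E[g(I\<^sub>t, U\<^sub>t)] + \<alpha> e(t + 1) - e t\<close>, because integrating \<open>v\<close> against the transition
  kernel gives its expectation one step later. Multiplied by \<open>\<alpha>^t\<close>, the terms in \<open>e\<close> telescope to
  \<open>- e 0\<close>, since \<open>e\<close> is bounded.
\<close>
lemma performance_identity:
  assumes v: "v \<in> bdd_borel \<I>"
  shows "(\<lambda>t. \<alpha> ^ t * (\<integral>\<omega>. gap v (\<omega> t) \<partial>\<P>)) sums (policy_cost M c \<alpha> \<gamma> I\<^sub>0 - v I\<^sub>0)"
proof -
  obtain B where B: "\<forall>I\<in>space \<I>. \<bar>v I\<bar> \<le> B"
    using bdd_borelD(3)[OF v] by blast
  define g where "g y = filtered_cost c (fst y) (snd y)" for y
  define e where "e t = (\<integral>\<omega>. v (fst (\<omega> t)) \<partial>\<P>)" for t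
  have g: "g \<in> borel_measurable \<S>" "\<And>y. y \<in> space \<S> \<Longrightarrow> \<bar>g y\<bar> \<le> C\<^sub>c"
    using g_measurable g_bounded by (auto simp: g_def[abs_def] case_prod_beta' space_pair_measure)
  have fstv: "(\<lambda>y. v (fst y)) \<in> borel_measurable \<S>"
    by (rule measurable_compose[OF measurable_fst bdd_borelD(1)[OF v]])
  have fstB: "\<bar>v (fst y)\<bar> \<le> B" if "y \<in> space \<S>" for y
    using B that by (auto simp: space_pair_measure)
  have KB: "\<bar>\<integral>I'. v I' \<partial>info_kernel M (fst y) (snd y)\<bar> \<le> B" if "y \<in> space \<S>" for y
    using B by (intro kernel_integral_bounded(2)[OF that bdd_borelD(1)[OF v]]) blast
  have gap: "(\<integral>\<omega>. gap v (\<omega> t) \<partial>\<P>) = (\<integral>\<omega>. g (\<omega> t) \<partial>\<P>) + \<alpha> * e (Suc t) - e t" for t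
    using integrable_traj[OF g, of t] integrable_traj[OF fstv fstB, of t]
      integrable_traj[OF kernel_integral_measurable[OF v] KB, of t]
    by (simp add: gap_def action_value_def g_def e_def integral_next_state[OF v])
  have powers: "summable (\<lambda>t. \<alpha> ^ t)"
    using discount by (intro summable_geometric) simp
  have "(\<lambda>t. \<integral>\<omega>. \<alpha> ^ t * g (\<omega> t) \<partial>\<P>) sums (\<integral>\<omega>. (\<Sum>t. \<alpha> ^ t * g (\<omega> t)) \<partial>\<P>)"
  proof (rule sums_integral)
    show "integrable \<P> (\<lambda>\<omega>. \<alpha> ^ t * g (\<omega> t))" for t
      by (intro integrable_mult_right integrable_traj[OF g])
    have "summable (\<lambda>t. norm (\<alpha> ^ t * g (\<omega> t)))" if "\<omega> \<in> space \<P>" for \<omega>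
      using g(2)[OF coordinate_in_space(1)[OF that]] discount
      by (intro summable_comparison_test'[OF summable_mult2[OF powers, of C\<^sub>c], of 0])
        (auto simp: abs_mult intro!: mult_left_mono)
    then show "AE \<omega> in \<P>. summable (\<lambda>t. norm (\<alpha> ^ t * g (\<omega> t)))"
      by (rule AE_I2)
    show "summable (\<lambda>t. \<integral>\<omega>. norm (\<alpha> ^ t * g (\<omega> t)) \<partial>\<P>)"
      using abs_expectation_le(2)[OF g] discount
      by (intro summable_comparison_test'[OF summable_mult2[OF powers, of C\<^sub>c], of 0])
        (auto simp: abs_mult intro!: mult_left_mono)
  qed
  then have cost: "(\<lambda>t. \<alpha> ^ t * (\<integral>\<omega>. g (\<omega> t) \<partial>\<P>)) sums policy_cost M c \<alpha> \<gamma> I\<^sub>0"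
    by (simp add: policy_cost_def g_def)
  have "(\<lambda>t. \<alpha> ^ t * e t) \<longlonglongrightarrow> 0"
  proof (rule Lim_null_comparison)
    show "\<forall>\<^sub>F t in sequentially. norm (\<alpha> ^ t * e t) \<le> \<alpha> ^ t * B"
      using abs_expectation_le(1)[OF fstv fstB] discount
      by (intro always_eventually) (auto simp: e_def abs_mult intro!: mult_left_mono)
    show "(\<lambda>t. \<alpha> ^ t * B) \<longlonglongrightarrow> 0"
      using discount by (intro tendsto_mult_left_zero LIMSEQ_power_zero) simp
  qed
  from sums_diff[OF cost telescope_sums'[OF this]] show ?thesis
    using integral_initial_state[OF v] by (simp add: gap e_def algebra_simps)
qed

text \<open>
  All gaps are nonnegative, hence so is the series in the performance identity.
\<close>
lemma value_le_policy_cost: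
  assumes v: "v \<in> bdd_borel \<I>"
    and sub: "\<And>I u. I \<in> space \<I> \<Longrightarrow> u \<in> space \<U> \<Longrightarrow> v I \<le> action_value v (I, u)"
  shows "v I\<^sub>0 \<le> policy_cost M c \<alpha> \<gamma> I\<^sub>0"
proof -
  have "0 \<le> gap v (\<omega> t)" if "\<omega> \<in> space \<P>" for \<omega> t
    using sub[OF coordinate_in_space(2,3)[OF that], of t t] by (simp add: gap_def)
  then have "0 \<le> \<alpha> ^ t * (\<integral>\<omega>. gap v (\<omega> t) \<partial>\<P>)" for t
    using discount by (intro mult_nonneg_nonneg integral_nonneg_AE) auto
  from sums_le[OF this sums_zero performance_identity[OF v]] show ?thesis
    by simp
qed

end

section \<open>Approaching the fixed point by policies\<close>

text \<open>
  Every expected gap is at most \<open>\<epsilon>\<close>: the action is replaced by its expression in the labels, and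
  then the near-optimality of \<open>s\<close> is used at the replayed states only. Summing against \<open>\<alpha>^t\<close>
  gives the geometric factor.
\<close>
lemma (in selected_run) selected_cost_le:
  assumes v: "v \<in> bdd_borel \<I>"
    and near: "\<And>I. I \<in> space \<I> \<Longrightarrow> action_value v (I, s I) \<le> v I + \<epsilon>"
    and \<epsilon>: "\<epsilon> \<ge> 0"
  shows "policy_cost M c \<alpha> (replay_policy M s I\<^sub>0) I\<^sub>0 \<le> v I\<^sub>0 + \<epsilon> / (1 - \<alpha>)"
proof -
  have "(\<integral>\<omega>. gap v (\<omega> t) \<partial>\<P>) \<le> \<epsilon>" for t
  proof (rule integral_real_bounded[OF \<epsilon>])
    \<comment> \<open>The bound is proved for the positive part of the gap, which is what a nonnegative integral
      of \<open>ennreal (gap v \<dots>)\<close> sees; this is enough for an upper bound.\<close>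
    note gap_measurable[OF v, measurable]
    have "(\<integral>\<^sup>+\<omega>. ennreal (gap v (\<omega> t)) \<partial>\<P>) =
        (\<integral>\<^sup>+\<omega>. ennreal (gap v (fst (\<omega> t), s (state (labels t \<omega> (fst (\<omega> t)))))) \<partial>\<P>)"
      by (rule nn_integral_action[where \<phi> = "\<lambda>_ y. ennreal (gap v y)"]) simp
    also have "\<dots> \<le> ennreal \<epsilon>"
    proof (rule nn_integral_state_le[where h = "\<lambda>ls I. ennreal (gap v (I, s (state ls)))"])
      show "(\<lambda>I. ennreal (gap v (I, s (state ls)))) \<in> borel_measurable \<I>" for ls
        using s by (intro measurable_compose[OF _ measurable_ennreal]
            measurable_compose[OF _ gap_measurable[OF v]]) simp
      show "ennreal (gap v (state ls, s (state ls))) \<le> ennreal \<epsilon>" if "ls \<in> lists (class_idx M)" for ls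
        using near[OF state_in_space[OF that]] by (intro ennreal_leI) (simp add: gap_def)
    qed
    finally show "(\<integral>\<^sup>+\<omega>. ennreal (gap v (\<omega> t)) \<partial>\<P>) \<le> ennreal \<epsilon>" .
  qed
  then have terms: "\<alpha> ^ t * (\<integral>\<omega>. gap v (\<omega> t) \<partial>\<P>) \<le> \<alpha> ^ t * \<epsilon>" for t
    using discount by (intro mult_left_mono) auto
  have "(\<lambda>t. \<alpha> ^ t * \<epsilon>) sums (1 / (1 - \<alpha>) * \<epsilon>)"
    using discount by (intro sums_mult2 geometric_sums) simp
  from sums_le[OF terms performance_identity[OF v] this] show ?thesis
    by simp
qed

text \<open>
  The optimal value is an infimum taken separately at each initial state, so the near-optimal policy
  may be tailored to the state \<open>I\<close> at hand: it is the replay policy started in \<open>I\<close>.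
\<close>
lemma (in filtered_mdp) fixed_point_eq_opt_value:
  assumes V: "V \<in> bdd_borel \<I>" and fixed: "bellman M c \<alpha> V = V"
  shows "V = opt_value M c \<alpha>"
proof (rule extensionalityI)
  show "V \<in> extensional (space \<I>)"
    by (rule bdd_borelD(2)[OF V])
  show "opt_value M c \<alpha> \<in> extensional (space \<I>)"
    by (simp add: opt_value_def)
  fix I assume I: "I \<in> space \<I>"
  have lower: "V I \<le> policy_cost M c \<alpha> \<gamma> I" if "\<gamma> \<in> policies M" for \<gamma>
  proof -
    interpret policy_run M c \<alpha> C\<^sub>c \<gamma> I
      by unfold_locales (rule that, rule I)
    show ?thesis
      using bellman_le_action_value[OF V] by (intro value_le_policy_cost V) (simp add: fixed)
  qed
  have upper: "\<exists>\<gamma>\<in>policies M. policy_cost M c \<alpha> \<gamma> I \<le> V I + \<epsilon> / (1 - \<alpha>)" if "\<epsilon> > 0" for \<epsilon>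
  proof -
    have "\<exists>u\<in>space \<U>. I \<in> space \<I> \<longrightarrow> action_value V (I, u) \<le> V I + \<epsilon>" for I
      using near_optimal_action[OF V _ \<open>\<epsilon> > 0\<close>, of I] action_space_nonempty
      by (cases "I \<in> space \<I>") (auto simp: fixed intro: less_imp_le)
    then obtain s where sel: "\<And>I. s I \<in> space \<U>"
      "\<And>I. I \<in> space \<I> \<Longrightarrow> action_value V (I, s I) \<le> V I + \<epsilon>"
      by metis
    interpret selected_run M c \<alpha> C\<^sub>c s I
      by unfold_locales (rule sel(1), rule I)
    show ?thesis
      using selected_cost_le[OF V sel(2)] \<open>\<epsilon> > 0\<close>
      by (intro bexI[OF _ replay_policy_in_policies]) simp
  qed
  have "opt_value M c \<alpha> I = (INF \<gamma>\<in>policies M. policy_cost M c \<alpha> \<gamma> I)"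
    using I by (simp add: opt_value_def)
  also have "\<dots> = V I"
  proof (rule antisym)
    have bdd: "bdd_below ((\<lambda>\<gamma>. policy_cost M c \<alpha> \<gamma> I) ` policies M)"
      using lower by (rule bdd_belowI2)
    show "(INF \<gamma>\<in>policies M. policy_cost M c \<alpha> \<gamma> I) \<le> V I"
    proof (rule field_le_epsilon)
      fix \<delta> :: real assume "\<delta> > 0"
      \<comment> \<open>A loss of \<open>\<delta> (1 - \<alpha>)\<close> at each step adds up to \<open>\<delta>\<close>.\<close>
      then have "\<delta> * (1 - \<alpha>) > 0"
        using discount by simp
      from upper[OF this] obtain \<gamma> where "\<gamma> \<in> policies M" "policy_cost M c \<alpha> \<gamma> I \<le> V I + \<delta>"
        using discount by auto
      with cINF_lower[OF bdd] show "(INF \<gamma>\<in>policies M. policy_cost M c \<alpha> \<gamma> I) \<le> V I + \<delta>"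
        by (blast intro: order_trans)
    qed
    show "V I \<le> (INF \<gamma>\<in>policies M. policy_cost M c \<alpha> \<gamma> I)"
      using upper[of 1] lower by (intro cINF_greatest) auto
  qed
  finally show "V I = opt_value M c \<alpha> I" by simp
qed

section \<open>Value iteration\<close>

lemma sup_norm_least:
  assumes "space N \<noteq> {}" "\<And>x. x \<in> space N \<Longrightarrow> \<bar>v x\<bar> \<le> B"
  shows "sup_norm N v \<le> B"
  unfolding sup_norm_def using assms by (rule cSUP_least)

lemma sup_norm_upper:
  assumes "\<And>x. x \<in> space N \<Longrightarrow> \<bar>v x\<bar> \<le> B" "x \<in> space N"
  shows "\<bar>v x\<bar> \<le> sup_norm N v"
  unfolding sup_norm_def using assms(1) by (intro cSUP_upper[OF assms(2)] bdd_aboveI2)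

theorem theorem6:
  fixes M :: "('x, 'u, 'e, 'v) obs_model"
    and c :: "'x \<times> 'u \<Rightarrow> real" and \<alpha> C\<^sub>c :: real
  assumes model: "wf_obs_model M"
    and discount: "0 < \<alpha>" "\<alpha> < 1"
    and c_measurable: "c \<in> borel_measurable (stX M \<Otimes>\<^sub>M actU M)"
    and c_bounded: "\<And>x u. x \<in> space (stX M) \<Longrightarrow> u \<in> space (actU M) \<Longrightarrow> \<bar>c (x, u)\<bar> \<le> C\<^sub>c"
    and g_measurable:
      "(\<lambda>(I, u). filtered_cost c I u) \<in> borel_measurable (info_space M \<Otimes>\<^sub>M actU M)"
    and K_kernel:
      "(\<lambda>(I, u). info_kernel M I u) \<in>
         info_space M \<Otimes>\<^sub>M actU M \<rightarrow>\<^sub>M prob_algebra (info_space M)"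
    and inf_version:
      "\<And>v. v \<in> bdd_borel (info_space M) \<Longrightarrow>
         \<exists>w\<in>bdd_borel (info_space M). \<forall>I\<in>space (info_space M).
           w I = (INF u\<in>space (actU M).
                    filtered_cost c I u + \<alpha> * (\<integral>I'. v I' \<partial>info_kernel M I u))"
  shows "\<exists>V. V \<in> bdd_borel (info_space M) \<and> bellman M c \<alpha> V = V \<and>
             (\<forall>W\<in>bdd_borel (info_space M). bellman M c \<alpha> W = W \<longrightarrow> W = V) \<and>
             V = opt_value M c \<alpha> \<and>
             opt_value M c \<alpha> = bellman M c \<alpha> (opt_value M c \<alpha>) \<and>
             (\<forall>v\<^sub>0\<in>bdd_borel (info_space M). \<forall>n.
                sup_norm (info_space M) (\<lambda>I. (bellman M c \<alpha> ^^ n) v\<^sub>0 I - opt_value M c \<alpha> I)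
                  \<le> \<alpha> ^ n * sup_norm (info_space M) (\<lambda>I. v\<^sub>0 I - opt_value M c \<alpha> I)) \<and>
             sup_norm (info_space M) (opt_value M c \<alpha>) \<le> C\<^sub>c / (1 - \<alpha>)"
proof -
  interpret filtered_mdp M c \<alpha> C\<^sub>c
    by unfold_locales (fact model discount c_bounded g_measurable K_kernel)+
  have maps: "bellman M c \<alpha> v \<in> bdd_borel \<I>" if v: "v \<in> bdd_borel \<I>" for v
  proof -
    obtain w where w: "w \<in> bdd_borel \<I>" "\<forall>I\<in>space \<I>. w I = (INF u\<in>space (actU M).
        filtered_cost c I u + \<alpha> * (\<integral>I'. v I' \<partial>info_kernel M I u))"
      using inf_version[OF v] by blast
    have "bellman M c \<alpha> v = w"
      using w(2) bdd_borelD(2)[OF w(1)]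
      by (intro extensionalityI[of _ "space \<I>"]) (auto simp: bellman_def)
    with w(1) show ?thesis by simp
  qed
  have "\<exists>V\<in>bdd_borel \<I>. bellman M c \<alpha> V = V"
    by (rule bdd_borel_contraction_fixed_point[OF maps bellman_contraction discount])
  then obtain V where V: "V \<in> bdd_borel \<I>" and fixed: "bellman M c \<alpha> V = V"
    by blast
  have opt: "opt_value M c \<alpha> = V"
    using fixed_point_eq_opt_value[OF V fixed] by simp
  have unique: "W = V" if "W \<in> bdd_borel \<I>" "bellman M c \<alpha> W = W" for W
    using fixed_point_eq_opt_value[OF that] opt by simp
  have iterate: "sup_norm \<I> (\<lambda>I. (bellman M c \<alpha> ^^ n) v I - V I) \<le> \<alpha> ^ n * sup_norm \<I> (\<lambda>I. v I - V I)"
    if v: "v \<in> bdd_borel \<I>" for v n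
  proof (rule sup_norm_least[OF info_space_nonempty])
    let ?d = "sup_norm \<I> (\<lambda>I. v I - V I)"
    obtain Bv BV where B: "\<forall>I\<in>space \<I>. \<bar>v I\<bar> \<le> Bv" "\<forall>I\<in>space \<I>. \<bar>V I\<bar> \<le> BV"
      using bdd_borelD(3)[OF v] bdd_borelD(3)[OF V] by blast
    have base: "\<bar>v I - V I\<bar> \<le> ?d" if "I \<in> space \<I>" for I
    proof (rule sup_norm_upper[OF _ that])
      show "\<bar>v J - V J\<bar> \<le> Bv + BV" if "J \<in> space \<I>" for J
        using B that abs_triangle_ineq4[of "v J" "V J"] by fastforce
    qed
    have "(bellman M c \<alpha> ^^ n) v \<in> bdd_borel \<I> \<and>
        (\<forall>I\<in>space \<I>. \<bar>(bellman M c \<alpha> ^^ n) v I - V I\<bar> \<le> \<alpha> ^ n * ?d)"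
    proof (induction n)
      case 0
      then show ?case using v base by simp
    next
      case (Suc n)
      then have "\<bar>bellman M c \<alpha> ((bellman M c \<alpha> ^^ n) v) I - bellman M c \<alpha> V I\<bar> \<le> \<alpha> * (\<alpha> ^ n * ?d)"
        if "I \<in> space \<I>" for I
        using that by (intro bellman_contraction V) auto
      with Suc show ?case
        by (simp add: maps fixed mult.assoc)
    qed
    then show "\<bar>(bellman M c \<alpha> ^^ n) v I - V I\<bar> \<le> \<alpha> ^ n * ?d" if "I \<in> space \<I>" for I
      using that by blast
  qed
  have norm: "sup_norm \<I> V \<le> C\<^sub>c / (1 - \<alpha>)"
  proof -
    obtain B where B: "\<forall>I\<in>space \<I>. \<bar>V I\<bar> \<le> B"
      using bdd_borelD(3)[OF V] by blast
    have "\<bar>V I\<bar> \<le> C\<^sub>c + \<alpha> * sup_norm \<I> V" if I: "I \<in> space \<I>" for I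
    proof -
      have "\<bar>action_value V (I, u)\<bar> \<le> C\<^sub>c + \<alpha> * sup_norm \<I> V" if "u \<in> space \<U>" for u
        using I that B by (intro action_value_bounded V sup_norm_upper[of \<I> V B])
          (auto simp: space_pair_measure)
      then have "\<bar>INF u\<in>space \<U>. action_value V (I, u)\<bar> \<le> C\<^sub>c + \<alpha> * sup_norm \<I> V"
        using action_space_nonempty by (intro cInf_abs_ge) auto
      then show ?thesis
        using bellman_eq[OF I, of V] fixed by simp
    qed
    then have "sup_norm \<I> V \<le> C\<^sub>c + \<alpha> * sup_norm \<I> V"
      by (rule sup_norm_least[OF info_space_nonempty])
    then show ?thesis
      using discount by (simp add: field_simps)
  qed
  show ?thesis
    unfolding opt
    by (intro exI[of _ V] conjI ballI allI impI V fixed fixed[symmetric] unique iterate norm refl)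
qed

end
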